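(* Not every algebraic pair has a mirror symmetric one: if $E$ is a complex elliptic curve with complex multiplication, then there exists $\omega\in C_{E\times E}$ such that no algebraic pair is mirror symmetric to the algebraic pair $(E\times E,\omega)$.
   Context: An abelian variety is written $A=(V/\Gamma,J)$ with $\Gamma=\Gamma_A=H_1(A,\mathbb Z)$, $V=V_A=\Gamma\otimes\mathbb R$, and $J=J_A\in\mathrm{End}(V)$, $J^2=-1$. The dual is $\hat A=(V^*/\Gamma^*,\hat J)$, $(\hat Jw)(v)=w(-Jv)$. The Néron–Severi group $NS_A$ is identified (by first Chern class) with the group of integral skew-symmetric forms $c$ on $\Gamma$ with $c_{\mathbb R}$ $J$-invariant, and with a subgroup of $\mathrm{Hom}(A,\hat A)$ via $c\mapsto(v\mapsto c(v,\cdot))$. $NS_A(\mathbb R)=NS_A\otimes\mathbb R$, $NS_A(\mathbb C)=NS_A\otimes\mathbb C$. $C_A^a\subset NS_A(\mathbb R)$ is the ample cone, and $C_A=(NS_A(\mathbb R)+iC_A^a)\sqcup(NS_A(\mathbb R)-iC_A^a)\subset NS_A(\mathbb C)$. Put $\Lambda_A=\Gamma_A\oplus\Gamma_{\hat A}$ ($\Gamma_{\hat A}=\Gamma_A^*$) with $Q_A((a_1,b_1),(a_2,b_2))=b_1(a_2)+b_2(a_1)$; $J_{A\times\hat A}=(J,\hat J)$ acts on $V_A\oplus V_{\hat A}$. For $\omega=\varphi_1+i\varphi_2\in C_A$ (with $\varphi_k:V_A\to V_{\hat A}$) put $$I_\omega=\begin{pmatrix}\varphi_2^{-1}\varphi_1&-\varphi_2^{-1}\\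 \varphi_2+\varphi_1\varphi_2^{-1}\varphi_1&-\varphi_1\varphi_2^{-1}\end{pmatrix},$$ a complex structure on $V_A\oplus V_{\hat A}$. An algebraic pair $(A,\omega_A)$ is an abelian variety $A$ with $\omega_A\in C_A$. Algebraic pairs $(A,\omega_A)$, $(B,\omega_B)$ are mirror symmetric if there is an isomorphism $\alpha:\Lambda_A\to\Lambda_B$ identifying $Q_A$ with $Q_B$ such that $\alpha_{\mathbb R}J_{A\times\hat A}=I_{\omega_B}\alpha_{\mathbb R}$ and $\alpha_{\mathbb R}I_{\omega_A}=J_{B\times\hat B}\alpha_{\mathbb R}$. *)

theory Defs
  imports
    "HOL.Complex"
    "Jordan_Normal_Form.Matrix"
    "Jordan_Normal_Form.Gauss_Jordan_Elimination"
begin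

text \<open>
  A complex torus \<open>(V/\<Gamma>, J)\<close> is given in terms of a \<open>\<int>\<close>-basis of \<open>\<Gamma>\<close>: writing \<open>m\<close> for the rank of
  \<open>\<Gamma>\<close>, we have \<open>\<Gamma> = \<int>\<^sup>m\<close> and \<open>V = \<Gamma> \<otimes> \<real> = \<real>\<^sup>m\<close>, so that the torus is just the
  real \<open>m \<times> m\<close> matrix \<open>J\<close>, with \<open>m = dim_row J\<close>.  Dual spaces carry the dual basis: the
  value of \<open>b \<in> V\<^sup>* = \<real>\<^sup>m\<close> at \<open>v \<in> V\<close> is \<open>b \<bullet> v\<close>, and \<open>\<Gamma>\<^sup>* = \<int>\<^sup>m\<close>.
\<close>

definition lattice :: "nat \<Rightarrow> real vec set" where
  "lattice m = {v \<in> carrier_vec m. \<forall>i<m. v $ i \<in> \<int>}"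

definition complex_torus :: "real mat \<Rightarrow> bool" where
  "complex_torus J \<longleftrightarrow>
     J \<in> carrier_mat (dim_row J) (dim_row J) \<and> J * J = - 1\<^sub>m (dim_row J)"

definition prod_torus :: "real mat \<Rightarrow> real mat \<Rightarrow> real mat" where
  "prod_torus J\<^sub>1 J\<^sub>2 =
     four_block_mat J\<^sub>1 (0\<^sub>m (dim_row J\<^sub>1) (dim_col J\<^sub>2)) (0\<^sub>m (dim_row J\<^sub>2) (dim_col J\<^sub>1)) J\<^sub>2"

definition dual_torus :: "real mat \<Rightarrow> real mat" where
  "dual_torus J = (- J)\<^sup>T"

lemma dual_torus_apply:
  assumes "J \<in> carrier_mat m m" "w \<in> carrier_vec m" "v \<in> carrier_vec m"
  shows "(dual_torus J *\<^sub>v w) \<bullet> v = w \<bullet> ((- J) *\<^sub>v v)"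
proof -
  have "- J \<in> carrier_mat m m" using assms(1) by simp
  from transpose_vec_mult_scalar[OF this assms(3) assms(2)]
  show ?thesis unfolding dual_torus_def .
qed

text \<open>
  A bilinear form \<open>c\<close> on \<open>V\<close> is identified with the map \<open>\<phi> : V \<rightarrow> V\<^sup>*\<close>, \<open>v \<mapsto> c(v, \<cdot>)\<close>.
\<close>

definition form :: "real mat \<Rightarrow> real vec \<Rightarrow> real vec \<Rightarrow> real" where
  "form \<phi> v w = (\<phi> *\<^sub>v v) \<bullet> w"

definition NS :: "real mat \<Rightarrow> real mat set" where
  "NS J = {\<phi> \<in> carrier_mat (dim_row J) (dim_row J).
     (\<forall>v\<in>lattice (dim_row J). \<forall>w\<in>lattice (dim_row J). form \<phi> v w \<in> \<int>) \<and>
     (\<forall>v\<in>lattice (dim_row J). \<forall>w\<in>lattice (dim_row J). form \<phi> v w = - form \<phi> w v) \<and>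
     (\<forall>v\<in>carrier_vec (dim_row J). \<forall>w\<in>carrier_vec (dim_row J).
        form \<phi> (J *\<^sub>v v) (J *\<^sub>v w) = form \<phi> v w)}"

text \<open>
  Since \<open>NS J \<otimes> \<real>\<close> injects into the space of real bilinear forms, it is taken to be the real
  span of \<open>NS J\<close> there.
\<close>

inductive_set NS_real :: "real mat \<Rightarrow> real mat set" for J :: "real mat" where
  NS_real_base: "\<phi> \<in> NS J \<Longrightarrow> \<phi> \<in> NS_real J"
| NS_real_add: "\<phi> \<in> NS_real J \<Longrightarrow> \<psi> \<in> NS_real J \<Longrightarrow> \<phi> + \<psi> \<in> NS_real J"
| NS_real_smult: "\<phi> \<in> NS_real J \<Longrightarrow> r \<cdot>\<^sub>m \<phi> \<in> NS_real J"

text \<open>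
  By Lefschetz, a class in \<open>NS J\<close> is the first Chern class of an ample line bundle iff
  \<open>c(J v, v) > 0\<close> for \<open>v \<noteq> 0\<close>.  The opposite sign convention replaces \<open>ample_cone\<close> by its
  negative, which affects neither \<open>abelian_variety\<close> nor \<open>complexified_cone\<close> below.
\<close>

definition ample_class :: "real mat \<Rightarrow> real mat \<Rightarrow> bool" where
  "ample_class J \<phi> \<longleftrightarrow> \<phi> \<in> NS J \<and>
     (\<forall>v\<in>carrier_vec (dim_row J). v \<noteq> 0\<^sub>v (dim_row J) \<longrightarrow> form \<phi> (J *\<^sub>v v) v > 0)"

definition abelian_variety :: "real mat \<Rightarrow> bool" where
  "abelian_variety J \<longleftrightarrow> complex_torus J \<and> (\<exists>\<phi>. ample_class J \<phi>)"

inductive_set ample_cone :: "real mat \<Rightarrow> real mat set" for J :: "real mat" where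
  ample_cone_base: "ample_class J \<phi> \<Longrightarrow> \<phi> \<in> ample_cone J"
| ample_cone_add: "\<phi> \<in> ample_cone J \<Longrightarrow> \<psi> \<in> ample_cone J \<Longrightarrow> \<phi> + \<psi> \<in> ample_cone J"
| ample_cone_smult: "\<phi> \<in> ample_cone J \<Longrightarrow> r > 0 \<Longrightarrow> r \<cdot>\<^sub>m \<phi> \<in> ample_cone J"

text \<open>The set \<open>C\<^sub>A\<close>.\<close>

definition complexified_cone :: "real mat \<Rightarrow> complex mat set" where
  "complexified_cone J =
     {map_mat complex_of_real \<phi>\<^sub>1 + \<i> \<cdot>\<^sub>m map_mat complex_of_real \<phi>\<^sub>2 | \<phi>\<^sub>1 \<phi>\<^sub>2.
        \<phi>\<^sub>1 \<in> NS_real J \<and> \<phi>\<^sub>2 \<in> ample_cone J} \<union>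
     {map_mat complex_of_real \<phi>\<^sub>1 - \<i> \<cdot>\<^sub>m map_mat complex_of_real \<phi>\<^sub>2 | \<phi>\<^sub>1 \<phi>\<^sub>2.
        \<phi>\<^sub>1 \<in> NS_real J \<and> \<phi>\<^sub>2 \<in> ample_cone J}"

definition algebraic_pair :: "real mat \<Rightarrow> complex mat \<Rightarrow> bool" where
  "algebraic_pair J \<omega> \<longleftrightarrow> abelian_variety J \<and> \<omega> \<in> complexified_cone J"

definition I_mat :: "complex mat \<Rightarrow> real mat" where
  "I_mat \<omega> =
     (let \<phi>\<^sub>1 = map_mat Re \<omega>; \<phi>\<^sub>2 = map_mat Im \<omega>; \<psi> = the (mat_inverse \<phi>\<^sub>2)
      in four_block_mat (\<psi> * \<phi>\<^sub>1) (- \<psi>) (\<phi>\<^sub>2 + \<phi>\<^sub>1 * \<psi> * \<phi>\<^sub>1) (- (\<phi>\<^sub>1 * \<psi>)))"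

text \<open>
  \<open>\<Lambda>\<^sub>A = \<Gamma>\<^sub>A \<oplus> \<Gamma>\<^sub>A\<^sup>*\<close> is \<open>lattice (m + m)\<close>; the first \<open>m\<close> coordinates are those of \<open>\<Gamma>\<^sub>A\<close>.
\<close>

definition Q_form :: "nat \<Rightarrow> real vec \<Rightarrow> real vec \<Rightarrow> real" where
  "Q_form m x y = vec_last x m \<bullet> vec_first y m + vec_last y m \<bullet> vec_first x m"

text \<open>
  The matrix \<open>\<alpha>\<close> is \<open>\<alpha>\<^sub>\<real>\<close>; additive maps between the lattices correspond to the matrices mapping
  one into the other.
\<close>

definition mirror_symmetric ::
    "real mat \<Rightarrow> complex mat \<Rightarrow> real mat \<Rightarrow> complex mat \<Rightarrow> bool" where
  "mirror_symmetric J\<^sub>A \<omega>\<^sub>A J\<^sub>B \<omega>\<^sub>B \<longleftrightarrow>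
     (let m = dim_row J\<^sub>A; n = dim_row J\<^sub>B in
      \<exists>\<alpha> \<in> carrier_mat (n + n) (m + m).
        bij_betw (\<lambda>x. \<alpha> *\<^sub>v x) (lattice (m + m)) (lattice (n + n)) \<and>
        (\<forall>x\<in>lattice (m + m). \<forall>y\<in>lattice (m + m).
           Q_form n (\<alpha> *\<^sub>v x) (\<alpha> *\<^sub>v y) = Q_form m x y) \<and>
        \<alpha> * prod_torus J\<^sub>A (dual_torus J\<^sub>A) = I_mat \<omega>\<^sub>B * \<alpha> \<and>
        \<alpha> * I_mat \<omega>\<^sub>A = prod_torus J\<^sub>B (dual_torus J\<^sub>B) * \<alpha>)"

definition elliptic_curve :: "real mat \<Rightarrow> bool" where
  "elliptic_curve J \<longleftrightarrow> abelian_variety J \<and> dim_row J = 2"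

definition torus_End :: "real mat \<Rightarrow> real mat set" where
  "torus_End J = {f \<in> carrier_mat (dim_row J) (dim_row J).
     (\<forall>v\<in>lattice (dim_row J). f *\<^sub>v v \<in> lattice (dim_row J)) \<and> f * J = J * f}"

definition has_CM :: "real mat \<Rightarrow> bool" where
  "has_CM J \<longleftrightarrow> torus_End J \<noteq> range (\<lambda>k::int. of_int k \<cdot>\<^sub>m 1\<^sub>m (dim_row J))"

end

theory Submission
  imports Defs
    "HOL-Analysis.Continuum_Not_Denumerable"
    "HOL-Computational_Algebra.Polynomial"
begin

text \<open>
  Suppose \<open>(B, \<omega>\<^sub>B)\<close> is a mirror partner of \<open>(A, \<omega>)\<close>, via \<open>\<alpha>\<close>. The factor \<open>V\<^sub>B\<close> of \<open>V\<^sub>B \<oplus> V\<^sub>B\<^sup>*\<close> is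
  rational and stable under the complex structure of the product of \<open>B\<close> with its dual, so \<open>\<alpha>\<close> pulls it back to a
  nonzero proper rational subspace of \<open>V\<^sub>A \<oplus> V\<^sub>A\<^sup>*\<close> that is stable under \<open>I\<^sub>\<omega>\<close>
  (\<open>mirror_gives_invariant_sublattice\<close>). It is therefore enough to find \<open>\<omega>\<close> for which \<open>I\<^sub>\<omega>\<close>
  has no such subspace.

  If \<open>E = (\<real>\<^sup>2/\<int>\<^sup>2, J)\<close> has complex multiplication, some real multiple \<open>G = c J\<close>, \<open>c \<noteq> 0\<close>, is
  integral. Given a polarization \<open>\<psi>\<close> of \<open>E\<close>, the classes on \<open>E \<times> E\<close> include the Hermitian matrices
  \<open>\<Phi>(a, b, x, y) = \<psi> [[a, x + y G], [x - y G, b]]\<close>, four real parameters instead of the three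
  that exist without complex multiplication. The inverse of \<open>\<Phi>\<close> is, up to a scalar, given by the
  adjugate Hermitian matrix, and the scalar involves the determinant \<open>a b - x\<^sup>2 - c\<^sup>2 y\<^sup>2\<close>.

  Take \<open>\<omega> = i \<Phi>\<close> with \<open>a, b, x, y\<close> integral polynomials of degree at most 3 in a transcendental
  \<open>t > 0\<close>. Then \<open>I\<^sub>\<omega> (v, w) = (- \<Phi>\<^sup>-\<^sup>1 w, \<Phi> v)\<close>. The determinant has degree 6 in \<open>t\<close>, so an
  integral linear condition on \<open>I\<^sub>\<omega> (v, w)\<close> with \<open>v, w\<close> integral can hold only if it
  holds for each of the eight coefficient matrices of \<open>a, b, x, y\<close> in \<open>\<Phi>\<close> and in its adjugate
  separately (\<open>rational_annihilation\<close>). An invariant rational subspace is thus stable under all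
  eight. They generate an algebra that acts irreducibly over the rational numbers: they produce
  every elementary matrix over the order generated by \<open>G\<close>, and \<open>u\<close> and \<open>G u\<close> are independent for
  \<open>u \<noteq> 0\<close> (\<open>no_invariant_sublattice\<close>).
\<close>

section \<open>Separating coefficients with a transcendental number\<close>

text \<open>
  Reals that are algebraic over the rational numbers are roots of the countably many nonzero
  integral polynomials, each of which has finitely many roots.
\<close>
lemma countable_algebraic: "countable {x::real. algebraic x}"
proof -
  have "{x::real. algebraic x} \<subseteq>
      (\<Union>p \<in> range Poly - {0 :: int poly}. {x. poly (map_poly of_int p) x = 0})"
  proof
    fix x :: real assume "x \<in> {x. algebraic x}"
    then obtain p where "p \<noteq> 0" "poly (map_poly of_int p) x = 0"
      by (auto elim: algebraicE')
    moreover have "p \<in> range Poly" by (rule range_eqI[of _ _ "coeffs p"]) simp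
    ultimately show "x \<in> (\<Union>p \<in> range Poly - {0 :: int poly}.
        {x. poly (map_poly of_int p) x = 0})" by blast
  qed
  moreover have "countable (\<Union>p \<in> range Poly - {0 :: int poly}.
      {x::real. poly (map_poly of_int p) x = 0})"
    by (intro countable_UN countable_Diff countable_image countableI_type countable_finite
        poly_roots_finite) (auto simp: poly_eq_iff coeff_map_poly)
  ultimately show ?thesis by (rule countable_subset)
qed

lemma exists_positive_transcendental: "\<exists>t::real. t > 0 \<and> \<not> algebraic t"
proof -
  have "\<not> {0<..<1::real} \<subseteq> {x. algebraic x}"
    using countable_subset[OF _ countable_algebraic] uncountable_open_interval[of 0 "1::real"] by auto
  then show ?thesis by auto
qed

text \<open>
  Transcendence turns the vanishing at \<open>t\<close> into the polynomial identity \<open>p d + e = 0\<close>, and then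
  \<open>deg e < deg d\<close> leaves no room for cancellation.
\<close>
lemma transcendental_separates_degrees:
  fixes t :: real and p d e :: "real poly"
  assumes t: "\<not> algebraic t"
    and int: "\<And>i. coeff p i \<in> \<int>" "\<And>i. coeff d i \<in> \<int>" "\<And>i. coeff e i \<in> \<int>"
    and deg: "degree e < degree d"
    and root: "poly p t * poly d t + poly e t = 0"
  shows "p = 0 \<and> e = 0"
proof -
  have "coeff (p * d + e) i \<in> \<int>" for i
    using int by (auto simp: coeff_mult intro!: Ints_add Ints_sum Ints_mult)
  moreover have "poly (p * d + e) t = 0" using root by simp
  ultimately have 0: "p * d + e = 0" using t algebraicI by blast
  have "d \<noteq> 0" using deg by auto
  have "p = 0"
  proof (rule ccontr)
    assume "p \<noteq> 0"
    then have "degree (p * d) \<ge> degree d" using \<open>d \<noteq> 0\<close> by (simp add: degree_mult_eq)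
    moreover have "e = - (p * d)" using 0 by (simp add: add_eq_0_iff)
    ultimately show False using deg by simp
  qed
  then show ?thesis using 0 by simp
qed

text \<open>
  These are the first two coordinates of the combination
  \<open>(1, 1, 0, 0) + t (1, 2, 0, 0) + t\<^sup>2 (2, 2, 1, 0) + t\<^sup>3 (2, N + 1, 0, 1)\<close>; the other two are
  \<open>t\<^sup>2\<close> and \<open>t\<^sup>3\<close>. With \<open>N = c\<^sup>2\<close> the four vectors are coordinates of ample classes (\<open>Phi_ample\<close>),
  and they are linearly independent.
\<close>
definition wt_a :: "real \<Rightarrow> real" where "wt_a t = 1 + t + 2 * t^2 + 2 * t^3"
definition wt_b :: "real \<Rightarrow> real \<Rightarrow> real" where "wt_b N t = 1 + 2 * t + 2 * t^2 + (N + 1) * t^3"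

text \<open>
  In \<open>t\<close> the determinant \<open>a b - x\<^sup>2 - N y\<^sup>2\<close> has degree 6, with leading coefficient
  \<open>2 (N + 1) - N = N + 2\<close>, whereas \<open>a, b, x, y\<close> are linearly independent polynomials of degree at
  most 3.
\<close>
lemma coefficient_separation:
  fixes t N k :: real
  assumes t: "\<not> algebraic t" and N: "N \<in> \<int>" "N > 0" and k: "k \<in> \<int>" "k \<noteq> 0"
    and int: "c1 \<in> \<int>" "c2 \<in> \<int>" "c3 \<in> \<int>" "c4 \<in> \<int>" "e1 \<in> \<int>" "e2 \<in> \<int>" "e3 \<in> \<int>" "e4 \<in> \<int>"
    and root: "k * (wt_a t * wt_b N t - (t^2)^2 - N * (t^3)^2)
         * (wt_a t * c1 + wt_b N t * c2 + t^2 * c3 + t^3 * c4)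
       + (wt_b N t * e1 + wt_a t * e2 - t^2 * e3 - t^3 * e4) = 0"
  shows "c1 = 0 \<and> c2 = 0 \<and> c3 = 0 \<and> c4 = 0 \<and> e1 = 0 \<and> e2 = 0 \<and> e3 = 0 \<and> e4 = 0"
proof -
  define a :: "real poly" where "a = [:1, 1, 2, 2:]"
  define b :: "real poly" where "b = [:1, 2, 2, N + 1:]"
  define d where "d = smult k (a * b - [:0,0,1:]^2 - smult N ([:0,0,0,1:]^2))"
  define p where "p = smult c1 a + smult c2 b + [:0, 0, c3, c4:]"
  define e where "e = smult e1 b + smult e2 a - [:0, 0, e3, e4:]"
  have pa: "poly a t = wt_a t" "poly b t = wt_b N t"
    by (auto simp: a_def b_def wt_a_def wt_b_def power2_eq_square power3_eq_cube algebra_simps)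
  have d': "d = [:k, k*3, k*6, k*(N+9), k*(N+8), k*(2*N+6), k*(N+2):]"
    unfolding d_def a_def b_def by (simp add: power2_eq_square algebra_simps)
  have "N + 2 \<noteq> 0" using N by linarith
  then have dd: "degree d = 6" unfolding d' using k by simp
  have coeff4: "coeff [:x0,x1,x2,x3:] i \<in> \<int>"
    if "x0 \<in> \<int>" "x1 \<in> \<int>" "x2 \<in> \<int>" "x3 \<in> \<int>" for x0 x1 x2 x3 :: real and i
    using that by (auto simp: coeff_pCons split: nat.split)
  have p': "p = [:c1 + c2, c1 + 2 * c2, 2 * c1 + 2 * c2 + c3, 2 * c1 + (N + 1) * c2 + c4:]"
    unfolding p_def a_def b_def by (simp add: algebra_simps)
  have e': "e = [:e1 + e2, 2 * e1 + e2, 2 * e1 + 2 * e2 - e3, (N + 1) * e1 + 2 * e2 - e4:]"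
    unfolding e_def a_def b_def by (simp add: algebra_simps)
  have "coeff d i \<in> \<int>" for i
    unfolding d' using k N by (auto simp: coeff_pCons split: nat.split intro!: Ints_mult Ints_add Ints_diff)
  moreover have "coeff p i \<in> \<int>" for i unfolding p'
    using int N by (intro coeff4 Ints_add Ints_mult) auto
  moreover have "coeff e i \<in> \<int>" for i unfolding e'
    using int N by (intro coeff4 Ints_add Ints_diff Ints_mult) auto
  moreover have "degree e < degree d" unfolding dd e' by simp
  moreover have "poly p t * poly d t + poly e t = 0"
  proof -
    have "poly p t = wt_a t * c1 + wt_b N t * c2 + t^2 * c3 + t^3 * c4"
      unfolding p_def by (simp add: pa power2_eq_square power3_eq_cube algebra_simps)
    moreover have "poly d t = k * (wt_a t * wt_b N t - (t^2)^2 - N * (t^3)^2)"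
      unfolding d_def by (simp add: pa power2_eq_square power3_eq_cube algebra_simps)
    moreover have "poly e t = wt_b N t * e1 + wt_a t * e2 - t^2 * e3 - t^3 * e4"
      unfolding e_def by (simp add: pa power2_eq_square power3_eq_cube algebra_simps)
    ultimately show ?thesis using root by (simp add: mult.commute)
  qed
  ultimately have "p = 0 \<and> e = 0" using transcendental_separates_degrees[OF t] by blast
  then have c: "c1 + c2 = 0" "c1 + 2 * c2 = 0" "2 * c1 + 2 * c2 + c3 = 0" "2 * c1 + (N + 1) * c2 + c4 = 0"
    and e: "e1 + e2 = 0" "2 * e1 + e2 = 0" "2 * e1 + 2 * e2 - e3 = 0" "(N + 1) * e1 + 2 * e2 - e4 = 0"
    unfolding p' e' by auto
  from c(1,2) have "c1 = 0" "c2 = 0" by linarith+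
  moreover from e(1,2) have "e1 = 0" "e2 = 0" by linarith+
  ultimately show ?thesis using c(3,4) e(3,4) by simp
qed

(* Matrix entries are addressed by the numerals 0 and 1, which the simplifier must not turn into Suc 0. *)
declare One_nat_def[simp del]

section \<open>Two-dimensional matrices and integral vectors\<close>

lemma less_two_iff: "i < 2 \<longleftrightarrow> i = 0 \<or> i = (1::nat)" by auto

lemma sum_two: "sum f {0..<2} = f 0 + f (1::nat)" for f :: "nat \<Rightarrow> real"
  by (simp add: numeral_2_eq_2 One_nat_def)

lemma scalar_prod_two:
  "u \<in> carrier_vec 2 \<Longrightarrow> v \<in> carrier_vec 2 \<Longrightarrow> u \<bullet> v = u $ 0 * v $ 0 + u $ 1 * v $ 1" for u v :: "real vec"
  by (simp add: scalar_prod_def sum_two)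

lemma mult_vec_two:
  fixes A :: "real mat"
  assumes "A \<in> carrier_mat 2 2" "v \<in> carrier_vec 2"
  shows "(A *\<^sub>v v) $ 0 = A $$ (0,0) * v $ 0 + A $$ (0,1) * v $ 1"
    "(A *\<^sub>v v) $ 1 = A $$ (1,0) * v $ 0 + A $$ (1,1) * v $ 1"
  using assms by (simp_all add: scalar_prod_def sum_two)

lemma mult_mat_two:
  fixes A :: "real mat"
  assumes "A \<in> carrier_mat 2 2" "B \<in> carrier_mat 2 2" "i < 2" "j < 2"
  shows "(A * B) $$ (i,j) = A $$ (i,0) * B $$ (0,j) + A $$ (i,1) * B $$ (1,j)"
  using assms by (simp add: scalar_prod_def sum_two)

lemma vec_two_eqI:
  assumes "u \<in> carrier_vec 2" "v \<in> carrier_vec 2" "u $ 0 = v $ 0" "u $ 1 = v $ 1"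
  shows "u = v"
  using assms by (intro eq_vecI) (auto simp: less_two_iff)

lemma mat_two_eqI:
  assumes "A \<in> carrier_mat 2 2" "B \<in> carrier_mat 2 2"
    "A $$ (0,0) = B $$ (0,0)" "A $$ (0,1) = B $$ (0,1)" "A $$ (1,0) = B $$ (1,0)" "A $$ (1,1) = B $$ (1,1)"
  shows "A = B"
  using assms by (intro eq_matI) (auto simp: less_two_iff)

lemma four_block_cong:
  "A = A' \<Longrightarrow> B = B' \<Longrightarrow> C = C' \<Longrightarrow> D = D' \<Longrightarrow> four_block_mat A B C D = four_block_mat A' B' C' D'"
  by simp

lemma lattice_carrier: "v \<in> lattice m \<Longrightarrow> v \<in> carrier_vec m"
  by (simp add: lattice_def)

lemma carrier_append_cases:
  assumes "v \<in> carrier_vec (m + n)"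
  obtains v1 v2 where "v = v1 @\<^sub>v v2" "v1 \<in> carrier_vec m" "v2 \<in> carrier_vec n"
  using assms vec_first_last_append[OF assms] by (metis vec_first_carrier vec_last_carrier)

lemma lattice_append_iff:
  assumes "v1 \<in> carrier_vec m" "v2 \<in> carrier_vec n"
  shows "v1 @\<^sub>v v2 \<in> lattice (m + n) \<longleftrightarrow> v1 \<in> lattice m \<and> v2 \<in> lattice n"
proof
  assume v: "v1 @\<^sub>v v2 \<in> lattice (m + n)"
  have "v1 $ i \<in> \<int>" if "i < m" for i
    using v that assms unfolding lattice_def by (auto dest!: spec[of _ i])
  moreover have "v2 $ i \<in> \<int>" if "i < n" for i
    using v that assms unfolding lattice_def by (auto dest!: spec[of _ "m + i"])
  ultimately show "v1 \<in> lattice m \<and> v2 \<in> lattice n" using assms by (simp add: lattice_def)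
next
  assume "v1 \<in> lattice m \<and> v2 \<in> lattice n"
  then show "v1 @\<^sub>v v2 \<in> lattice (m + n)" using assms by (auto simp: lattice_def)
qed

lemma lattice_append_cases:
  assumes "v \<in> lattice (m + n)"
  obtains v1 v2 where "v = v1 @\<^sub>v v2" "v1 \<in> lattice m" "v2 \<in> lattice n"
proof -
  obtain v1 v2 where v: "v = v1 @\<^sub>v v2" "v1 \<in> carrier_vec m" "v2 \<in> carrier_vec n"
    using carrier_append_cases[OF lattice_carrier[OF assms]] .
  then show ?thesis using that assms by (auto simp: lattice_append_iff)
qed

lemma lattice_mult_mat_vec:
  assumes "A \<in> carrier_mat m n" "\<And>i j. i < m \<Longrightarrow> j < n \<Longrightarrow> A $$ (i,j) \<in> \<int>" "v \<in> lattice n"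
  shows "A *\<^sub>v v \<in> lattice m"
  using assms by (auto simp: lattice_def scalar_prod_def intro!: Ints_sum Ints_mult)

lemma lattice_scalar_prod: "u \<in> lattice n \<Longrightarrow> v \<in> lattice n \<Longrightarrow> u \<bullet> v \<in> \<int>"
  by (auto simp: lattice_def scalar_prod_def intro!: Ints_sum Ints_mult)

lemma lattice_uminus: "v \<in> lattice n \<Longrightarrow> - v \<in> lattice n"
  by (auto simp: lattice_def)

lemma lattice_zero: "0\<^sub>v n \<in> lattice n"
  by (auto simp: lattice_def)

lemma append_zero_vec: "0\<^sub>v m @\<^sub>v 0\<^sub>v n = (0\<^sub>v (m + n) :: real vec)"
  by (intro eq_vecI) auto

lemma lattice_unit_vec: "unit_vec n i \<in> lattice n"
  by (auto simp: lattice_def unit_vec_def)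

lemma integral_entries:
  fixes A :: "real mat"
  assumes A: "A \<in> carrier_mat m n" and map: "\<And>v. v \<in> lattice n \<Longrightarrow> A *\<^sub>v v \<in> lattice m"
    and "i < m" "j < n"
  shows "A $$ (i,j) \<in> \<int>"
proof -
  have "(A *\<^sub>v unit_vec n j) $ i = A $$ (i,j)" using assms by simp
  moreover have "(A *\<^sub>v unit_vec n j) $ i \<in> \<int>"
    using map[OF lattice_unit_vec[of n j]] \<open>i < m\<close> unfolding lattice_def by blast
  ultimately show ?thesis by metis
qed

lemma smult_mat_mult_vec:
  "A \<in> carrier_mat m n \<Longrightarrow> v \<in> carrier_vec n \<Longrightarrow> (k \<cdot>\<^sub>m A) *\<^sub>v v = k \<cdot>\<^sub>v (A *\<^sub>v v)" for A :: "real mat"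
  by (rule eq_vecI) (auto simp: scalar_prod_def sum_distrib_left mult.assoc)

lemma complex_structure_two:
  fixes J :: "real mat"
  assumes J: "J \<in> carrier_mat 2 2" "J * J = - 1\<^sub>m 2"
  shows "J $$ (1,1) = - J $$ (0,0)" "J $$ (0,0) * J $$ (0,0) + J $$ (0,1) * J $$ (1,0) = - 1" "J $$ (0,1) \<noteq> 0"
proof -
  have *: "(J * J) $$ (i,j) = (- 1\<^sub>m 2) $$ (i,j)" for i j by (simp only: J(2))
  show 1: "J $$ (0,0) * J $$ (0,0) + J $$ (0,1) * J $$ (1,0) = - 1"
    using *[of 0 0] J(1) by (simp add: mult_mat_two del: index_mult_mat)
  have "J $$ (0,0) * J $$ (0,1) + J $$ (0,1) * J $$ (1,1) = 0"
    using *[of 0 1] J(1) by (simp add: mult_mat_two del: index_mult_mat)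
  then have "J $$ (0,1) * (J $$ (0,0) + J $$ (1,1)) = 0" by (simp add: algebra_simps)
  moreover show "J $$ (0,1) \<noteq> 0"
    using 1 by (metis add.right_neutral mult_zero_left neg_0_le_iff_le not_one_le_zero zero_le_square)
  ultimately show "J $$ (1,1) = - J $$ (0,0)" by simp
qed

text \<open>
  For a purely imaginary class the diagonal blocks vanish and only \<open>\<Phi>\<close> and its inverse remain.
\<close>
lemma I_mat_imaginary:
  fixes \<Phi> \<Psi> :: "real mat"
  assumes \<Phi>: "\<Phi> \<in> carrier_mat n n" and \<Psi>: "\<Psi> \<in> carrier_mat n n"
    and inv: "\<Phi> * \<Psi> = 1\<^sub>m n" "\<Psi> * \<Phi> = 1\<^sub>m n"
  shows "I_mat (map_mat complex_of_real (0\<^sub>m n n) + \<i> \<cdot>\<^sub>m map_mat complex_of_real \<Phi>)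
    = four_block_mat (0\<^sub>m n n) (- \<Psi>) \<Phi> (0\<^sub>m n n)"
proof -
  let ?\<omega> = "map_mat complex_of_real (0\<^sub>m n n) + \<i> \<cdot>\<^sub>m map_mat complex_of_real \<Phi>"
  have re: "map_mat Re ?\<omega> = 0\<^sub>m n n" and im: "map_mat Im ?\<omega> = \<Phi>"
    using \<Phi> by (auto intro!: eq_matI)
  have "mat_inverse \<Phi> = Some \<Psi>"
  proof (cases "mat_inverse \<Phi>")
    case None
    then have "\<Phi> \<notin> Units (ring_mat TYPE(real) n ())" by (rule mat_inverse(1)[OF \<Phi>])
    then show ?thesis using \<Phi> \<Psi> inv unfolding Units_def by (auto simp: ring_mat_simps)
  next
    case (Some B)
    then have B: "B * \<Phi> = 1\<^sub>m n" "B \<in> carrier_mat n n" using mat_inverse(2)[OF \<Phi>] by auto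
    have "B = B * (\<Phi> * \<Psi>)" using B inv by simp
    also have "\<dots> = \<Psi>" using B \<Phi> \<Psi> by (simp add: assoc_mult_mat[symmetric, of _ n n _ n _ n])
    finally show ?thesis using Some by simp
  qed
  then show ?thesis
    unfolding I_mat_def re im Let_def using \<Phi> \<Psi>
    by (auto intro!: four_block_cong)
qed

section \<open>Polarizations on the square of a curve with complex multiplication\<close>

text \<open>
  Complex multiplication enters through the integrality of \<open>c J\<close> (\<open>CM_multiple_integral\<close>): this matrix
  is an endomorphism of the curve whose square is the negative integer \<open>- c\<^sup>2\<close>. A skew form in dimension
  two is determined by one entry, and positivity of \<open>\<psi>\<close> fixes its sign.
\<close>
locale CM_curve =
  fixes J \<psi> :: "real mat" and c :: real
  assumes J [simp]: "J \<in> carrier_mat 2 2" and J_sq: "J * J = - 1\<^sub>m 2"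
    and \<psi> [simp]: "\<psi> \<in> carrier_mat 2 2"
    and \<psi>_skew [simp]: "\<psi> $$ (0,0) = 0" "\<psi> $$ (1,1) = 0" "\<psi> $$ (1,0) = - \<psi> $$ (0,1)"
    and \<psi>_int: "\<psi> $$ (0,1) \<in> \<int>"
    and \<psi>_pos: "\<And>v. v \<in> carrier_vec 2 \<Longrightarrow> v \<noteq> 0\<^sub>v 2 \<Longrightarrow> (\<psi> *\<^sub>v (J *\<^sub>v v)) \<bullet> v > 0"
    and c: "c \<noteq> 0"
    and cJ_int: "\<And>i j. i < 2 \<Longrightarrow> j < 2 \<Longrightarrow> c * J $$ (i,j) \<in> \<int>"
begin

definition "G = c \<cdot>\<^sub>m J"

lemma G [simp]: "G \<in> carrier_mat 2 2"
  by (simp add: G_def)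

lemma product_carrier [simp]: "\<psi> * G \<in> carrier_mat 2 2" "G * \<psi> \<in> carrier_mat 2 2"
  by (rule mult_carrier_mat[of _ 2 2], auto)+

lemma mult_carrier [simp]: "v \<in> carrier_vec 2 \<Longrightarrow> \<psi> *\<^sub>v v \<in> carrier_vec 2"
  "v \<in> carrier_vec 2 \<Longrightarrow> J *\<^sub>v v \<in> carrier_vec 2" "v \<in> carrier_vec 2 \<Longrightarrow> G *\<^sub>v v \<in> carrier_vec 2"
  by (rule mult_mat_vec_carrier[of _ 2 2], auto)+

lemma dims [simp]: "dim_row J = 2" "dim_col J = 2" "dim_row \<psi> = 2" "dim_col \<psi> = 2" "dim_row G = 2" "dim_col G = 2"
  using J \<psi> G by (auto simp del: J \<psi> G)

lemma G_entry [simp]: "i < 2 \<Longrightarrow> j < 2 \<Longrightarrow> G $$ (i,j) = c * J $$ (i,j)"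
  using J by (simp add: G_def)

lemmas J_entries = complex_structure_two(1,2)[OF J J_sq]

lemma c_sq_int: "c\<^sup>2 \<in> \<int>"
proof -
  have "c\<^sup>2 = - (c * J $$ (0,0) * (c * J $$ (0,0)) + c * J $$ (0,1) * (c * J $$ (1,0)))"
  proof -
    have "c * J $$ (0,0) * (c * J $$ (0,0)) + c * J $$ (0,1) * (c * J $$ (1,0))
        = c\<^sup>2 * (J $$ (0,0) * J $$ (0,0) + J $$ (0,1) * J $$ (1,0))"
      by (simp add: power2_eq_square algebra_simps)
    then show ?thesis by (simp add: J_entries(2))
  qed
  also have "\<dots> \<in> \<int>" by (intro Ints_minus Ints_add Ints_mult[OF cJ_int cJ_int]) auto
  finally show ?thesis .
qed

lemma \<psi>_nonzero: "\<psi> $$ (0,1) \<noteq> 0"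
proof
  assume 0: "\<psi> $$ (0,1) = 0"
  let ?e = "unit_vec 2 0 :: real vec"
  have "?e \<noteq> 0\<^sub>v 2" by (metis index_unit_vec(2) index_zero_vec(1) zero_less_numeral zero_neq_one)
  then have "(\<psi> *\<^sub>v (J *\<^sub>v ?e)) \<bullet> ?e > 0" by (intro \<psi>_pos) auto
  then show False using 0 by (simp add: scalar_prod_two mult_vec_two del: index_mult_mat_vec)
qed

lemma \<psi>_sq: "v \<in> carrier_vec 2 \<Longrightarrow> \<psi> *\<^sub>v (\<psi> *\<^sub>v v) = - ((\<psi> $$ (0,1))\<^sup>2) \<cdot>\<^sub>v v"
  by (rule vec_two_eqI) (auto simp: mult_vec_two power2_eq_square simp del: index_mult_mat_vec)

lemma \<psi>_inj: "v \<in> carrier_vec 2 \<Longrightarrow> v \<noteq> 0\<^sub>v 2 \<Longrightarrow> \<psi> *\<^sub>v v \<noteq> 0\<^sub>v 2"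
proof
  assume v: "v \<in> carrier_vec 2" "v \<noteq> 0\<^sub>v 2" and 0: "\<psi> *\<^sub>v v = 0\<^sub>v 2"
  have "v $ 0 = 0" "v $ 1 = 0"
    using arg_cong[OF 0, of "\<lambda>w. w $ 0"] arg_cong[OF 0, of "\<lambda>w. w $ 1"] v \<psi>_nonzero
    by (simp_all add: mult_vec_two del: index_mult_mat_vec)
  then show False using v by (auto intro: vec_two_eqI)
qed

lemma \<psi>_lattice: "v \<in> lattice 2 \<Longrightarrow> \<psi> *\<^sub>v v \<in> lattice 2"
  using \<psi>_int by (intro lattice_mult_mat_vec[of _ 2 2]) (auto simp: less_two_iff)

lemma G_lattice: "v \<in> lattice 2 \<Longrightarrow> G *\<^sub>v v \<in> lattice 2"
  using cJ_int by (intro lattice_mult_mat_vec[of _ 2 2]) auto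

text \<open>
  As \<open>(\<psi> J u) \<bullet> u > 0\<close>, the vectors \<open>u\<close> and \<open>J u\<close> are linearly independent, so they span the plane.
\<close>
lemma spanning:
  assumes u: "u \<in> carrier_vec 2" "u \<noteq> 0\<^sub>v 2" and p: "p \<in> carrier_vec 2" and 0: "p \<bullet> u = 0" "p \<bullet> (G *\<^sub>v u) = 0"
  shows "p = 0\<^sub>v 2"
proof -
  have 1: "p $ 0 * u $ 0 + p $ 1 * u $ 1 = 0" using 0 u p by (simp add: scalar_prod_two)
  have "c * (p $ 0 * (J $$ (0,0) * u $ 0 + J $$ (0,1) * u $ 1) + p $ 1 * (J $$ (1,0) * u $ 0 + J $$ (1,1) * u $ 1)) = 0"
    using 0 u p by (simp add: scalar_prod_two mult_vec_two algebra_simps del: index_mult_mat_vec)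
  then have 2: "p $ 0 * (J $$ (0,0) * u $ 0 + J $$ (0,1) * u $ 1) + p $ 1 * (J $$ (1,0) * u $ 0 - J $$ (0,0) * u $ 1) = 0"
    using c by (simp add: J_entries)
  have q: "(\<psi> *\<^sub>v (J *\<^sub>v u)) \<bullet> u > 0" using \<psi>_pos u by blast
  define l where "l = J $$ (0,0) * u $ 0 + J $$ (0,1) * u $ 1"
  define m where "m = J $$ (1,0) * u $ 0 - J $$ (0,0) * u $ 1"
  define s where "s = m * u $ 0 - l * u $ 1"
  have "(\<psi> *\<^sub>v (J *\<^sub>v u)) \<bullet> u = \<psi> $$ (0,1) * s"
    using u by (simp add: s_def l_def m_def scalar_prod_two mult_vec_two J_entries algebra_simps del: index_mult_mat_vec)
  then have s: "s \<noteq> 0" using q by auto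
  have "p $ 0 * s = (p $ 0 * u $ 0 + p $ 1 * u $ 1) * m - (p $ 0 * l + p $ 1 * m) * u $ 1"
    "p $ 1 * s = (p $ 0 * l + p $ 1 * m) * u $ 0 - (p $ 0 * u $ 0 + p $ 1 * u $ 1) * l"
    unfolding s_def by (simp_all add: algebra_simps)
  then have "p $ 0 * s = 0" "p $ 1 * s = 0" using 1 2 unfolding l_def[symmetric] m_def[symmetric] by simp_all
  then show ?thesis using s p by (auto intro: vec_two_eqI)
qed

lemma spanning_dual:
  assumes u: "u \<in> carrier_vec 2" "u \<noteq> 0\<^sub>v 2" and q: "q \<in> carrier_vec 2"
    and 0: "q \<bullet> (\<psi> *\<^sub>v u) = 0" "q \<bullet> (\<psi> *\<^sub>v (G *\<^sub>v u)) = 0"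
  shows "q = 0\<^sub>v 2"
proof -
  have *: "q \<bullet> (\<psi> *\<^sub>v v) = - ((\<psi> *\<^sub>v q) \<bullet> v)" if "v \<in> carrier_vec 2" for v
    using q that by (simp add: scalar_prod_two mult_vec_two algebra_simps del: index_mult_mat_vec)
  have "\<psi> *\<^sub>v q = 0\<^sub>v 2" using u q 0 by (intro spanning[OF u]) (auto simp: *)
  then show ?thesis using \<psi>_inj q by blast
qed

text \<open>
  The Hermitian matrix \<open>[[a, x + y G], [x - y G, b]]\<close> followed by \<open>\<psi>\<close> on each factor; here \<open>G\<close> is
  purely imaginary, with \<open>G\<^sup>2 = - c\<^sup>2\<close>.
\<close>
definition Phi :: "real \<Rightarrow> real \<Rightarrow> real \<Rightarrow> real \<Rightarrow> real mat" where
  "Phi a b x y = four_block_mat (a \<cdot>\<^sub>m \<psi>) (x \<cdot>\<^sub>m \<psi> + y \<cdot>\<^sub>m (\<psi> * G)) (x \<cdot>\<^sub>m \<psi> - y \<cdot>\<^sub>m (\<psi> * G)) (b \<cdot>\<^sub>m \<psi>)"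

text \<open>
  The adjugate Hermitian matrix \<open>[[b, - x - y G], [- x + y G, a]]\<close> preceded by \<open>\<psi>\<close> on each factor.
\<close>
definition Phi_adj :: "real \<Rightarrow> real \<Rightarrow> real \<Rightarrow> real \<Rightarrow> real mat" where
  "Phi_adj a b x y = four_block_mat (b \<cdot>\<^sub>m \<psi>) (- (x \<cdot>\<^sub>m \<psi> + y \<cdot>\<^sub>m (G * \<psi>))) (- (x \<cdot>\<^sub>m \<psi> - y \<cdot>\<^sub>m (G * \<psi>))) (a \<cdot>\<^sub>m \<psi>)"

lemma Phi_carrier [simp]: "Phi a b x y \<in> carrier_mat (2 + 2) (2 + 2)" "Phi_adj a b x y \<in> carrier_mat (2 + 2) (2 + 2)"
  unfolding Phi_def Phi_adj_def by (intro four_block_carrier_mat, simp, simp)+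

lemma Phi_mult_vec:
  assumes [simp]: "v1 \<in> carrier_vec 2" "v2 \<in> carrier_vec 2"
  shows "Phi a b x y *\<^sub>v (v1 @\<^sub>v v2) =
     (a \<cdot>\<^sub>v (\<psi> *\<^sub>v v1) + (x \<cdot>\<^sub>v (\<psi> *\<^sub>v v2) + y \<cdot>\<^sub>v (\<psi> *\<^sub>v (G *\<^sub>v v2)))) @\<^sub>v
     ((x \<cdot>\<^sub>v (\<psi> *\<^sub>v v1) - y \<cdot>\<^sub>v (\<psi> *\<^sub>v (G *\<^sub>v v1))) + b \<cdot>\<^sub>v (\<psi> *\<^sub>v v2))"
  unfolding Phi_def
  by (subst four_block_mat_mult_vec[of _ 2 2 _ 2 _ 2])
    (auto intro!: arg_cong2[of _ _ _ _ append_vec] vec_two_eqI add_carrier_vec mult_mat_vec_carrier[of _ 2 2]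
      simp: mult_vec_two mult_mat_two minus_carrier_mat algebra_simps simp del: index_mult_mat_vec index_mult_mat(1))

lemma Phi_adj_mult_vec:
  assumes [simp]: "v1 \<in> carrier_vec 2" "v2 \<in> carrier_vec 2"
  shows "Phi_adj a b x y *\<^sub>v (v1 @\<^sub>v v2) =
     (b \<cdot>\<^sub>v (\<psi> *\<^sub>v v1) - (x \<cdot>\<^sub>v (\<psi> *\<^sub>v v2) + y \<cdot>\<^sub>v (G *\<^sub>v (\<psi> *\<^sub>v v2)))) @\<^sub>v
     (a \<cdot>\<^sub>v (\<psi> *\<^sub>v v2) - (x \<cdot>\<^sub>v (\<psi> *\<^sub>v v1) - y \<cdot>\<^sub>v (G *\<^sub>v (\<psi> *\<^sub>v v1))))"
  unfolding Phi_adj_def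
  by (subst four_block_mat_mult_vec[of _ 2 2 _ 2 _ 2])
    (auto intro!: arg_cong2[of _ _ _ _ append_vec] vec_two_eqI add_carrier_vec mult_mat_vec_carrier[of _ 2 2]
      simp: mult_vec_two mult_mat_two minus_carrier_mat algebra_simps simp del: index_mult_mat_vec index_mult_mat(1))

lemma product_entries:
  "(\<psi> * G) $$ (0,0) = \<psi> $$ (0,1) * (c * J $$ (1,0))"
  "(\<psi> * G) $$ (0,1) = - \<psi> $$ (0,1) * (c * J $$ (0,0))"
  "(\<psi> * G) $$ (1,0) = - \<psi> $$ (0,1) * (c * J $$ (0,0))"
  "(\<psi> * G) $$ (1,1) = - \<psi> $$ (0,1) * (c * J $$ (0,1))"
  "(G * \<psi>) $$ (0,0) = - \<psi> $$ (0,1) * (c * J $$ (0,1))"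
  "(G * \<psi>) $$ (0,1) = \<psi> $$ (0,1) * (c * J $$ (0,0))"
  "(G * \<psi>) $$ (1,0) = \<psi> $$ (0,1) * (c * J $$ (0,0))"
  "(G * \<psi>) $$ (1,1) = \<psi> $$ (0,1) * (c * J $$ (1,0))"
  by (simp_all add: mult_mat_two J_entries(1) del: index_mult_mat(1))

text \<open>
  The product of a Hermitian \<open>2 \<times> 2\<close> matrix with its adjugate is the determinant, and the
  remaining factor is \<open>\<psi>\<^sup>2 = - (\<psi> $$ (0,1))\<^sup>2\<close>.
\<close>
lemma Phi_adj_inverse:
  "Phi a b x y * Phi_adj a b x y = (- ((\<psi> $$ (0,1))\<^sup>2 * (a * b - x\<^sup>2 - c\<^sup>2 * y\<^sup>2))) \<cdot>\<^sub>m 1\<^sub>m (2 + 2)"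
  "Phi_adj a b x y * Phi a b x y = (- ((\<psi> $$ (0,1))\<^sup>2 * (a * b - x\<^sup>2 - c\<^sup>2 * y\<^sup>2))) \<cdot>\<^sub>m 1\<^sub>m (2 + 2)"
proof -
  let ?s = "- ((\<psi> $$ (0,1))\<^sup>2 * (a * b - x\<^sup>2 - c\<^sup>2 * y\<^sup>2))"
  have one: "?s \<cdot>\<^sub>m 1\<^sub>m (2 + 2) = four_block_mat (?s \<cdot>\<^sub>m 1\<^sub>m 2) (?s \<cdot>\<^sub>m 0\<^sub>m 2 2) (?s \<cdot>\<^sub>m 0\<^sub>m 2 2) (?s \<cdot>\<^sub>m 1\<^sub>m 2)"
    by (subst four_block_one_mat[symmetric], subst smult_four_block_mat[of _ 2 2 _ 2 _ 2]) auto
  have J2: "J $$ (0,0) * J $$ (0,0) = - 1 - J $$ (0,1) * J $$ (1,0)"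
    using J_entries(2) by linarith
  have J3: "J $$ (0,0) * (J $$ (0,0) * r) = (- 1 - J $$ (0,1) * J $$ (1,0)) * r" for r
    unfolding J2[symmetric] by simp
  note carr = add_carrier_mat uminus_carrier_mat mult_carrier_mat[of _ 2 2] minus_carrier_mat
  show "Phi a b x y * Phi_adj a b x y = ?s \<cdot>\<^sub>m 1\<^sub>m (2 + 2)"
    unfolding one Phi_def Phi_adj_def
    by (subst mult_four_block_mat[of _ 2 2 _ 2 _ 2 _ _ 2 _ 2])
      (auto intro!: four_block_cong mat_two_eqI carr
        simp: mult_mat_two product_entries minus_carrier_mat J2 J3 power2_eq_square algebra_simps simp del: index_mult_mat(1))
  show "Phi_adj a b x y * Phi a b x y = ?s \<cdot>\<^sub>m 1\<^sub>m (2 + 2)"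
    unfolding one Phi_def Phi_adj_def
    by (subst mult_four_block_mat[of _ 2 2 _ 2 _ 2 _ _ 2 _ 2])
      (auto intro!: four_block_cong mat_two_eqI carr
        simp: mult_mat_two product_entries minus_carrier_mat J2 J3 power2_eq_square algebra_simps simp del: index_mult_mat(1))
qed

lemma form_Phi:
  assumes [simp]: "v1 \<in> carrier_vec 2" "v2 \<in> carrier_vec 2" "w1 \<in> carrier_vec 2" "w2 \<in> carrier_vec 2"
  shows "form (Phi a b x y) (v1 @\<^sub>v v2) (w1 @\<^sub>v w2) =
    a * ((\<psi> *\<^sub>v v1) \<bullet> w1) + b * ((\<psi> *\<^sub>v v2) \<bullet> w2) + x * ((\<psi> *\<^sub>v v2) \<bullet> w1 + (\<psi> *\<^sub>v v1) \<bullet> w2)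
    + y * ((\<psi> *\<^sub>v (G *\<^sub>v v2)) \<bullet> w1 - (\<psi> *\<^sub>v (G *\<^sub>v v1)) \<bullet> w2)"
  unfolding form_def Phi_mult_vec[OF assms(1,2)]
  by (subst scalar_prod_append[of _ 2 _ 2])
    (auto simp: scalar_prod_two algebra_simps simp del: index_mult_mat_vec intro!: add_carrier_vec)

lemma prod_torus_carrier: "prod_torus J J \<in> carrier_mat (2 + 2) (2 + 2)"
  unfolding prod_torus_def by (intro four_block_carrier_mat J)

lemma prod_torus_dim [simp]: "dim_row (prod_torus J J) = 2 + 2"
  using prod_torus_carrier by blast

lemma prod_torus_vec:
  assumes "v1 \<in> carrier_vec 2" "v2 \<in> carrier_vec 2"
  shows "prod_torus J J *\<^sub>v (v1 @\<^sub>v v2) = (J *\<^sub>v v1) @\<^sub>v (J *\<^sub>v v2)"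
  unfolding prod_torus_def using assms
  by (subst four_block_mat_mult_vec[of _ 2 2 _ 2 _ 2])
    (auto intro!: arg_cong2[of _ _ _ _ append_vec] vec_two_eqI add_carrier_vec mult_mat_vec_carrier[of _ 2 2]
      simp: mult_vec_two simp del: index_mult_mat_vec)

lemma complex_torus_prod: "complex_torus (prod_torus J J)"
proof -
  have "prod_torus J J * prod_torus J J = four_block_mat (J * J) (0\<^sub>m 2 2) (0\<^sub>m 2 2) (J * J)"
    unfolding prod_torus_def
    by (subst mult_four_block_mat[of _ 2 2 _ 2 _ 2 _ _ 2 _ 2]) (auto intro!: four_block_cong)
  also have "\<dots> = - 1\<^sub>m (2 + 2)"
    unfolding J_sq four_block_one_mat[symmetric] by (rule eq_matI) auto
  finally show ?thesis using prod_torus_carrier by (simp add: complex_torus_def)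
qed

lemma J_symplectic:
  assumes "v \<in> carrier_vec 2" "w \<in> carrier_vec 2"
  shows "(\<psi> *\<^sub>v (J *\<^sub>v v)) \<bullet> (J *\<^sub>v w) = (\<psi> *\<^sub>v v) \<bullet> w"
proof -
  have "(\<psi> *\<^sub>v (J *\<^sub>v v)) \<bullet> (J *\<^sub>v w)
      = - (J $$ (0,0) * J $$ (0,0) + J $$ (0,1) * J $$ (1,0)) * ((\<psi> *\<^sub>v v) \<bullet> w)"
    using assms
    by (simp add: scalar_prod_two mult_vec_two J_entries(1) algebra_simps del: index_mult_mat_vec)
  then show ?thesis by (simp add: J_entries(2))
qed

lemma GJ: "v \<in> carrier_vec 2 \<Longrightarrow> G *\<^sub>v (J *\<^sub>v v) = J *\<^sub>v (G *\<^sub>v v)"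
  by (rule vec_two_eqI) (auto simp: mult_vec_two algebra_simps simp del: index_mult_mat_vec)

lemma \<psi>_alternating:
  "v \<in> carrier_vec 2 \<Longrightarrow> w \<in> carrier_vec 2 \<Longrightarrow> (\<psi> *\<^sub>v w) \<bullet> v = - ((\<psi> *\<^sub>v v) \<bullet> w)"
  by (simp add: scalar_prod_two mult_vec_two algebra_simps del: index_mult_mat_vec)

lemma \<psi>G_symmetric:
  "v \<in> carrier_vec 2 \<Longrightarrow> w \<in> carrier_vec 2 \<Longrightarrow> (\<psi> *\<^sub>v (G *\<^sub>v w)) \<bullet> v = (\<psi> *\<^sub>v (G *\<^sub>v v)) \<bullet> w"
  by (simp add: scalar_prod_two mult_vec_two J_entries(1) algebra_simps del: index_mult_mat_vec)

lemma Phi_NS: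
  assumes int: "a \<in> \<int>" "b \<in> \<int>" "x \<in> \<int>" "y \<in> \<int>"
  shows "Phi a b x y \<in> NS (prod_torus J J)"
proof -
  have carr: "Phi a b x y \<in> carrier_mat (2 + 2) (2 + 2)" by (rule Phi_carrier)
  have 1: "form (Phi a b x y) v w \<in> \<int>" "form (Phi a b x y) v w = - form (Phi a b x y) w v"
    if vw: "v \<in> lattice (2 + 2)" "w \<in> lattice (2 + 2)" for v w
  proof -
    obtain v1 v2 where v: "v = v1 @\<^sub>v v2" "v1 \<in> lattice 2" "v2 \<in> lattice 2" by (rule lattice_append_cases[OF vw(1)])
    obtain w1 w2 where w: "w = w1 @\<^sub>v w2" "w1 \<in> lattice 2" "w2 \<in> lattice 2" by (rule lattice_append_cases[OF vw(2)])
    note vc = lattice_carrier[OF v(2)] lattice_carrier[OF v(3)] lattice_carrier[OF w(2)] lattice_carrier[OF w(3)]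
    show "form (Phi a b x y) v w \<in> \<int>"
      unfolding v(1) w(1) form_Phi[OF vc]
      by (intro Ints_add Ints_mult Ints_diff int lattice_scalar_prod[of _ 2] \<psi>_lattice G_lattice v w)
    show "form (Phi a b x y) v w = - form (Phi a b x y) w v"
      unfolding v(1) w(1) form_Phi[OF vc] form_Phi[OF vc(3,4,1,2)]
      by (simp add: \<psi>_alternating[OF vc(1,3)] \<psi>_alternating[OF vc(1,4)] \<psi>_alternating[OF vc(2,3)]
          \<psi>_alternating[OF vc(2,4)] \<psi>G_symmetric[OF vc(1,4)] \<psi>G_symmetric[OF vc(2,3)] algebra_simps)
  qed
  have 2: "form (Phi a b x y) (prod_torus J J *\<^sub>v v) (prod_torus J J *\<^sub>v w) = form (Phi a b x y) v w"
    if vw: "v \<in> carrier_vec (2 + 2)" "w \<in> carrier_vec (2 + 2)" for v w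
  proof -
    obtain v1 v2 where v: "v = v1 @\<^sub>v v2" "v1 \<in> carrier_vec 2" "v2 \<in> carrier_vec 2" by (rule carrier_append_cases[OF vw(1)])
    obtain w1 w2 where w: "w = w1 @\<^sub>v w2" "w1 \<in> carrier_vec 2" "w2 \<in> carrier_vec 2" by (rule carrier_append_cases[OF vw(2)])
    show ?thesis using v(2,3) w(2,3)
      unfolding v(1) w(1) by (simp add: prod_torus_vec form_Phi GJ J_symplectic)
  qed
  show ?thesis unfolding NS_def prod_torus_dim using carr 1 2 by blast
qed

text \<open>
  Completing squares: the cross terms of \<open>x\<close> and \<open>y\<close> are absorbed into \<open>q (v1 + v2)\<close> and
  \<open>q (v1 + G v2)\<close>, where \<open>q (G v2) = c\<^sup>2 q v2\<close>. The class is then ample as soon as the first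
  two coefficients are positive and \<open>x\<close> and \<open>y\<close> are nonnegative.
\<close>
lemma Phi_polarization:
  assumes [simp]: "v1 \<in> carrier_vec 2" "v2 \<in> carrier_vec 2"
  defines "q \<equiv> \<lambda>v. (\<psi> *\<^sub>v (J *\<^sub>v v)) \<bullet> v"
  shows "form (Phi a b x y) (prod_torus J J *\<^sub>v (v1 @\<^sub>v v2)) (v1 @\<^sub>v v2)
    = (a - x - y) * q v1 + (b - x - c\<^sup>2 * y) * q v2 + x * q (v1 + v2) + y * q (v1 + G *\<^sub>v v2)"
proof -
  have "q (G *\<^sub>v v2) = c\<^sup>2 * q v2"
  proof -
    have "G *\<^sub>v v2 = c \<cdot>\<^sub>v (J *\<^sub>v v2)"
      by (rule vec_two_eqI) (auto simp: mult_vec_two algebra_simps simp del: index_mult_mat_vec)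
    then have "q (G *\<^sub>v v2) = c\<^sup>2 * q (J *\<^sub>v v2)"
      unfolding q_def by (simp add: scalar_prod_two mult_vec_two power2_eq_square algebra_simps del: index_mult_mat_vec)
    then show ?thesis unfolding q_def by (simp add: J_symplectic)
  qed
  moreover have "q (v1 + w) = q v1 + q w + 2 * ((\<psi> *\<^sub>v (J *\<^sub>v w)) \<bullet> v1)" if [simp]: "w \<in> carrier_vec 2" for w
    unfolding q_def by (simp add: carrier_vecD[OF that] scalar_prod_two mult_vec_two J_entries(1) algebra_simps del: index_mult_mat_vec)
  moreover have "(\<psi> *\<^sub>v (J *\<^sub>v v2)) \<bullet> v1 = (\<psi> *\<^sub>v (J *\<^sub>v v1)) \<bullet> v2"
    by (simp add: scalar_prod_two mult_vec_two J_entries(1) algebra_simps del: index_mult_mat_vec)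
  moreover have "(\<psi> *\<^sub>v (G *\<^sub>v (J *\<^sub>v v1))) \<bullet> v2 = - ((\<psi> *\<^sub>v (G *\<^sub>v (J *\<^sub>v v2))) \<bullet> v1)"
  proof -
    have "(\<psi> *\<^sub>v (G *\<^sub>v (J *\<^sub>v v1))) \<bullet> v2 = (\<psi> *\<^sub>v (G *\<^sub>v v2)) \<bullet> (J *\<^sub>v v1)"
      by (rule \<psi>G_symmetric) auto
    also have "\<dots> = - ((\<psi> *\<^sub>v (J *\<^sub>v v1)) \<bullet> (G *\<^sub>v v2))" by (rule \<psi>_alternating) auto
    also have "(\<psi> *\<^sub>v (J *\<^sub>v v1)) \<bullet> (G *\<^sub>v v2) = (\<psi> *\<^sub>v (J *\<^sub>v (G *\<^sub>v v2))) \<bullet> v1"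
      by (simp add: scalar_prod_two mult_vec_two J_entries(1) algebra_simps del: index_mult_mat_vec)
    finally show ?thesis by (simp add: GJ)
  qed
  ultimately show ?thesis
    by (simp add: prod_torus_vec form_Phi GJ q_def[symmetric] algebra_simps) (simp add: q_def algebra_simps)
qed

lemma Phi_ample:
  assumes int: "a \<in> \<int>" "b \<in> \<int>" "x \<in> \<int>" "y \<in> \<int>"
    and pos: "0 \<le> x" "0 \<le> y" "x + y < a" "x + c\<^sup>2 * y < b"
  shows "ample_class (prod_torus J J) (Phi a b x y)"
  unfolding ample_class_def prod_torus_dim
proof (intro conjI ballI impI)
  show "Phi a b x y \<in> NS (prod_torus J J)" using int by (rule Phi_NS)
  fix v :: "real vec" assume v: "v \<in> carrier_vec (2 + 2)" and v0: "v \<noteq> 0\<^sub>v (2 + 2)"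
  obtain v1 v2 where v12: "v = v1 @\<^sub>v v2" "v1 \<in> carrier_vec 2" "v2 \<in> carrier_vec 2" by (rule carrier_append_cases[OF v])
  let ?q = "\<lambda>v. (\<psi> *\<^sub>v (J *\<^sub>v v)) \<bullet> v"
  have q: "0 \<le> ?q u" if "u \<in> carrier_vec 2" for u
  proof (cases "u = 0\<^sub>v 2")
    case True
    then show ?thesis by (simp add: scalar_prod_two del: index_mult_mat_vec)
  next
    case False
    then show ?thesis using \<psi>_pos[OF that] by simp
  qed
  have "v1 \<noteq> 0\<^sub>v 2 \<or> v2 \<noteq> 0\<^sub>v 2" using v0 unfolding v12(1) by (auto simp: append_zero_vec[of 2 2, simplified])
  then have "0 < (a - x - y) * ?q v1 + (b - x - c\<^sup>2 * y) * ?q v2"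
    using pos q[OF v12(2)] q[OF v12(3)] \<psi>_pos[OF v12(2)] \<psi>_pos[OF v12(3)]
    by (metis add_nonneg_pos add_pos_nonneg diff_gt_0_iff_gt less_diff_eq less_imp_le mult_nonneg_nonneg mult_pos_pos add.commute)
  moreover have "0 \<le> x * ?q (v1 + v2)" "0 \<le> y * ?q (v1 + G *\<^sub>v v2)"
    using pos v12 by (auto intro!: mult_nonneg_nonneg q)
  ultimately show "0 < form (Phi a b x y) (prod_torus J J *\<^sub>v v) v"
    unfolding v12(1) Phi_polarization[OF v12(2,3)] by linarith
qed

lemma abelian_prod: "abelian_variety (prod_torus J J)"
  using complex_torus_prod Phi_ample[of 1 1 0 0] by (auto simp: abelian_variety_def)

lemma Phi_add: "Phi a b x y + Phi a' b' x' y' = Phi (a + a') (b + b') (x + x') (y + y')"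
  unfolding Phi_def
  by (subst add_four_block_mat[of _ 2 2 _ 2 _ 2])
    (auto intro!: four_block_cong eq_matI simp: algebra_simps simp del: index_mult_mat(1))

lemma Phi_smult: "r \<cdot>\<^sub>m Phi a b x y = Phi (r * a) (r * b) (r * x) (r * y)"
  unfolding Phi_def
  by (subst smult_four_block_mat[of _ 2 2 _ 2 _ 2])
    (auto intro!: four_block_cong eq_matI simp: algebra_simps simp del: index_mult_mat(1))

lemma Phi_in_ample_cone:
  assumes "t > 0"
  shows "Phi (wt_a t) (wt_b (c\<^sup>2) t) (t^2) (t^3) \<in> ample_cone (prod_torus J J)"
proof -
  have "Phi (wt_a t) (wt_b (c\<^sup>2) t) (t^2) (t^3) =
      1 \<cdot>\<^sub>m Phi 1 1 0 0 + t \<cdot>\<^sub>m Phi 1 2 0 0 + t^2 \<cdot>\<^sub>m Phi 2 2 1 0 + t^3 \<cdot>\<^sub>m Phi 2 (c\<^sup>2 + 1) 0 1"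
    by (simp add: Phi_add Phi_smult wt_a_def wt_b_def algebra_simps)
  also have "\<dots> \<in> ample_cone (prod_torus J J)"
    using assms c_sq_int
    by (intro ample_cone_add ample_cone_smult ample_cone_base Phi_ample) auto
  finally show ?thesis .
qed

definition imag_class :: "real \<Rightarrow> complex mat" where
  "imag_class t = map_mat complex_of_real (0\<^sub>m (2 + 2) (2 + 2))
     + \<i> \<cdot>\<^sub>m map_mat complex_of_real (Phi (wt_a t) (wt_b (c\<^sup>2) t) (t^2) (t^3))"

lemma imag_class_in_cone: "t > 0 \<Longrightarrow> imag_class t \<in> complexified_cone (prod_torus J J)"
proof -
  assume t: "t > 0"
  have "Phi 0 0 0 0 \<in> NS_real (prod_torus J J)" by (intro NS_real_base Phi_NS) auto
  moreover have "Phi 0 0 0 0 = 0\<^sub>m (2 + 2) (2 + 2)"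
    unfolding Phi_def by (rule eq_matI) auto
  ultimately show ?thesis using Phi_in_ample_cone[OF t] unfolding complexified_cone_def imag_class_def by auto
qed

section \<open>Rational subspaces invariant under the complex structure\<close>

lemma pairing_Phi:
  assumes [simp]: "v1 \<in> carrier_vec 2" "v2 \<in> carrier_vec 2" "q1 \<in> carrier_vec 2" "q2 \<in> carrier_vec 2"
  shows "(q1 @\<^sub>v q2) \<bullet> (Phi a b x y *\<^sub>v (v1 @\<^sub>v v2)) =
    a * (q1 \<bullet> (\<psi> *\<^sub>v v1)) + b * (q2 \<bullet> (\<psi> *\<^sub>v v2)) + x * (q1 \<bullet> (\<psi> *\<^sub>v v2) + q2 \<bullet> (\<psi> *\<^sub>v v1))
    + y * (q1 \<bullet> (\<psi> *\<^sub>v (G *\<^sub>v v2)) - q2 \<bullet> (\<psi> *\<^sub>v (G *\<^sub>v v1)))"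
  unfolding Phi_mult_vec[OF assms(1,2)]
  by (subst scalar_prod_append[of _ 2 _ 2])
    (auto simp: scalar_prod_two algebra_simps simp del: index_mult_mat_vec intro!: add_carrier_vec)

lemma pairing_Phi_adj:
  assumes [simp]: "w1 \<in> carrier_vec 2" "w2 \<in> carrier_vec 2" "p1 \<in> carrier_vec 2" "p2 \<in> carrier_vec 2"
  shows "(p1 @\<^sub>v p2) \<bullet> (Phi_adj a b x y *\<^sub>v (w1 @\<^sub>v w2)) =
    b * (p1 \<bullet> (\<psi> *\<^sub>v w1)) + a * (p2 \<bullet> (\<psi> *\<^sub>v w2)) - x * (p1 \<bullet> (\<psi> *\<^sub>v w2) + p2 \<bullet> (\<psi> *\<^sub>v w1))
    - y * (p1 \<bullet> (G *\<^sub>v (\<psi> *\<^sub>v w2)) - p2 \<bullet> (G *\<^sub>v (\<psi> *\<^sub>v w1)))"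
  unfolding Phi_adj_mult_vec[OF assms(1,2)]
  by (subst scalar_prod_append[of _ 2 _ 2])
    (auto simp: scalar_prod_two algebra_simps simp del: index_mult_mat_vec intro!: minus_carrier_vec)

text \<open>
  At the parameters \<open>(wt_a t, wt_b (c\<^sup>2) t, t\<^sup>2, t\<^sup>3)\<close>, the product of \<open>Phi\<close> and \<open>Phi_adj\<close> is the
  negative of this scalar.
\<close>
definition scaled_det :: "real \<Rightarrow> real" where
  "scaled_det t = (\<psi> $$ (0,1))\<^sup>2 * (wt_a t * wt_b (c\<^sup>2) t - (t^2)^2 - c\<^sup>2 * (t^3)^2)"

text \<open>
  If the determinant vanished, the separation of coefficients would fail for \<open>c1 = 1\<close> and all other
  coefficients zero.
\<close>
lemma scaled_det_nonzero:
  assumes "\<not> algebraic t"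
  shows "scaled_det t \<noteq> 0"
  using coefficient_separation[OF assms c_sq_int _ Ints_power[OF \<psi>_int, of 2], of 1 0 0 0 0 0 0 0] c \<psi>_nonzero
  unfolding scaled_det_def by auto

lemma I_mat_imag_class:
  assumes "\<not> algebraic t"
  shows "I_mat (imag_class t) = four_block_mat (0\<^sub>m (2 + 2) (2 + 2)) ((1 / scaled_det t) \<cdot>\<^sub>m Phi_adj (wt_a t) (wt_b (c\<^sup>2) t) (t^2) (t^3))
     (Phi (wt_a t) (wt_b (c\<^sup>2) t) (t^2) (t^3)) (0\<^sub>m (2 + 2) (2 + 2))"
proof -
  let ?P = "Phi (wt_a t) (wt_b (c\<^sup>2) t) (t^2) (t^3)" and ?Q = "Phi_adj (wt_a t) (wt_b (c\<^sup>2) t) (t^2) (t^3)"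
  have P: "?P \<in> carrier_mat (2+2) (2+2)" and Q: "?Q \<in> carrier_mat (2+2) (2+2)" by (rule Phi_carrier)+
  have "?P * ((- 1 / scaled_det t) \<cdot>\<^sub>m ?Q) = (- 1 / scaled_det t) \<cdot>\<^sub>m (?P * ?Q)" by (rule mult_smult_distrib[OF P Q])
  also have "\<dots> = 1\<^sub>m (2 + 2)"
    unfolding Phi_adj_inverse scaled_det_def[symmetric] using scaled_det_nonzero[OF assms] by (auto intro!: eq_matI)
  finally have 1: "?P * ((- 1 / scaled_det t) \<cdot>\<^sub>m ?Q) = 1\<^sub>m (2 + 2)" .
  have "((- 1 / scaled_det t) \<cdot>\<^sub>m ?Q) * ?P = (- 1 / scaled_det t) \<cdot>\<^sub>m (?Q * ?P)" by (rule mult_smult_assoc_mat[OF Q P])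
  also have "\<dots> = 1\<^sub>m (2 + 2)"
    unfolding Phi_adj_inverse scaled_det_def[symmetric] using scaled_det_nonzero[OF assms] by (auto intro!: eq_matI)
  finally have 2: "((- 1 / scaled_det t) \<cdot>\<^sub>m ?Q) * ?P = 1\<^sub>m (2 + 2)" .
  have 3: "(- 1 / scaled_det t) \<cdot>\<^sub>m ?Q \<in> carrier_mat (2 + 2) (2 + 2)" using Q by simp
  have "- ((- 1 / scaled_det t) \<cdot>\<^sub>m ?Q) = (1 / scaled_det t) \<cdot>\<^sub>m ?Q" by (rule eq_matI) auto
  then show ?thesis unfolding imag_class_def by (subst I_mat_imaginary[OF P 3 1 2]) simp
qed

text \<open>
  Multiplying by \<open>scaled_det t\<close> clears the only denominator, so that both sides become integral
  polynomials in \<open>t\<close> when the vectors are integral.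
\<close>
lemma pairing_I_mat:
  assumes t: "\<not> algebraic t"
    and [simp]: "v1 \<in> carrier_vec 2" "v2 \<in> carrier_vec 2" "w1 \<in> carrier_vec 2" "w2 \<in> carrier_vec 2"
     "p1 \<in> carrier_vec 2" "p2 \<in> carrier_vec 2" "q1 \<in> carrier_vec 2" "q2 \<in> carrier_vec 2"
  shows "scaled_det t * (((p1 @\<^sub>v p2) @\<^sub>v (q1 @\<^sub>v q2)) \<bullet> (I_mat (imag_class t) *\<^sub>v ((v1 @\<^sub>v v2) @\<^sub>v (w1 @\<^sub>v w2)))) =
    scaled_det t * ((q1 @\<^sub>v q2) \<bullet> (Phi (wt_a t) (wt_b (c\<^sup>2) t) (t^2) (t^3) *\<^sub>v (v1 @\<^sub>v v2)))
    + (p1 @\<^sub>v p2) \<bullet> (Phi_adj (wt_a t) (wt_b (c\<^sup>2) t) (t^2) (t^3) *\<^sub>v (w1 @\<^sub>v w2))"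
proof -
  let ?P = "Phi (wt_a t) (wt_b (c\<^sup>2) t) (t^2) (t^3)" and ?Q = "Phi_adj (wt_a t) (wt_b (c\<^sup>2) t) (t^2) (t^3)"
  have P: "?P \<in> carrier_mat (2+2) (2+2)" and Q: "?Q \<in> carrier_mat (2+2) (2+2)" by (rule Phi_carrier)+
  have v: "v1 @\<^sub>v v2 \<in> carrier_vec (2 + 2)" and w: "w1 @\<^sub>v w2 \<in> carrier_vec (2 + 2)"
    and p: "p1 @\<^sub>v p2 \<in> carrier_vec (2 + 2)" and q: "q1 @\<^sub>v q2 \<in> carrier_vec (2 + 2)"
    by (rule append_carrier_vec; simp)+
  have Pv: "?P *\<^sub>v (v1 @\<^sub>v v2) \<in> carrier_vec (2 + 2)" and Qw: "?Q *\<^sub>v (w1 @\<^sub>v w2) \<in> carrier_vec (2 + 2)"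
    using P Q v w by (auto intro!: mult_mat_vec_carrier)
  have "I_mat (imag_class t) *\<^sub>v ((v1 @\<^sub>v v2) @\<^sub>v (w1 @\<^sub>v w2))
      = (1 / scaled_det t) \<cdot>\<^sub>v (?Q *\<^sub>v (w1 @\<^sub>v w2)) @\<^sub>v (?P *\<^sub>v (v1 @\<^sub>v v2))"
    unfolding I_mat_imag_class[OF t]
    using P Q v w Pv Qw
    by (subst four_block_mat_mult_vec[of _ "2+2" "2+2" _ "2+2" _ "2+2"]) (auto simp: smult_mat_mult_vec)
  also have "((p1 @\<^sub>v p2) @\<^sub>v (q1 @\<^sub>v q2)) \<bullet> \<dots> =
     (1 / scaled_det t) * ((p1 @\<^sub>v p2) \<bullet> (?Q *\<^sub>v (w1 @\<^sub>v w2))) + (q1 @\<^sub>v q2) \<bullet> (?P *\<^sub>v (v1 @\<^sub>v v2))"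
    using p q Pv Qw by (subst scalar_prod_append[of _ "2+2" _ "2+2"]) auto
  finally show ?thesis using scaled_det_nonzero[OF t] by (simp add: field_simps)
qed

text \<open>
  A single integral condition on \<open>I\<^sub>\<omega> (v, w)\<close> splits into eight: the first four concern the
  coefficients of \<open>a, b, x, y\<close> in \<open>\<Phi> v\<close>, the last four those of \<open>b, a, - x, - y\<close> in the adjugate
  applied to \<open>w\<close>.
\<close>
lemma rational_annihilation:
  assumes t: "\<not> algebraic t"
    and L: "v1 \<in> lattice 2" "v2 \<in> lattice 2" "w1 \<in> lattice 2" "w2 \<in> lattice 2"
     "p1 \<in> lattice 2" "p2 \<in> lattice 2" "q1 \<in> lattice 2" "q2 \<in> lattice 2"
    and 0: "((p1 @\<^sub>v p2) @\<^sub>v (q1 @\<^sub>v q2)) \<bullet> (I_mat (imag_class t) *\<^sub>v ((v1 @\<^sub>v v2) @\<^sub>v (w1 @\<^sub>v w2))) = 0"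
  shows "q1 \<bullet> (\<psi> *\<^sub>v v1) = 0 \<and> q2 \<bullet> (\<psi> *\<^sub>v v2) = 0 \<and> q1 \<bullet> (\<psi> *\<^sub>v v2) + q2 \<bullet> (\<psi> *\<^sub>v v1) = 0 \<and>
    q1 \<bullet> (\<psi> *\<^sub>v (G *\<^sub>v v2)) - q2 \<bullet> (\<psi> *\<^sub>v (G *\<^sub>v v1)) = 0 \<and>
    p1 \<bullet> (\<psi> *\<^sub>v w1) = 0 \<and> p2 \<bullet> (\<psi> *\<^sub>v w2) = 0 \<and> p1 \<bullet> (\<psi> *\<^sub>v w2) + p2 \<bullet> (\<psi> *\<^sub>v w1) = 0 \<and>
    p1 \<bullet> (G *\<^sub>v (\<psi> *\<^sub>v w2)) - p2 \<bullet> (G *\<^sub>v (\<psi> *\<^sub>v w1)) = 0"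
proof (rule coefficient_separation[OF t c_sq_int _ Ints_power[OF \<psi>_int, of 2]])
  note C = L[THEN lattice_carrier]
  show "0 < c\<^sup>2" "(\<psi> $$ (0,1))\<^sup>2 \<noteq> 0" using c \<psi>_nonzero by auto
  show "(\<psi> $$ (0,1))\<^sup>2 * (wt_a t * wt_b (c\<^sup>2) t - (t\<^sup>2)\<^sup>2 - c\<^sup>2 * (t ^ 3)\<^sup>2) *
      (wt_a t * (q1 \<bullet> (\<psi> *\<^sub>v v1)) + wt_b (c\<^sup>2) t * (q2 \<bullet> (\<psi> *\<^sub>v v2)) + t\<^sup>2 * (q1 \<bullet> (\<psi> *\<^sub>v v2) + q2 \<bullet> (\<psi> *\<^sub>v v1))
        + t ^ 3 * (q1 \<bullet> (\<psi> *\<^sub>v (G *\<^sub>v v2)) - q2 \<bullet> (\<psi> *\<^sub>v (G *\<^sub>v v1)))) +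
      (wt_b (c\<^sup>2) t * (p1 \<bullet> (\<psi> *\<^sub>v w1)) + wt_a t * (p2 \<bullet> (\<psi> *\<^sub>v w2)) - t\<^sup>2 * (p1 \<bullet> (\<psi> *\<^sub>v w2) + p2 \<bullet> (\<psi> *\<^sub>v w1))
        - t ^ 3 * (p1 \<bullet> (G *\<^sub>v (\<psi> *\<^sub>v w2)) - p2 \<bullet> (G *\<^sub>v (\<psi> *\<^sub>v w1)))) = 0"
    using pairing_I_mat[OF t C] unfolding 0 pairing_Phi[OF C(1,2,7,8)] pairing_Phi_adj[OF C(3,4,5,6)] scaled_det_def
    by simp
qed (auto intro!: Ints_add Ints_diff lattice_scalar_prod[of _ 2] \<psi>_lattice G_lattice L)

text \<open>
  The set \<open>R\<close> plays the role of integral equations for a rational subspace, and \<open>x0\<close> shows that the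
  subspace is nonzero. The conclusion says that it is the whole space.
\<close>
theorem no_invariant_sublattice:
  assumes t: "\<not> algebraic t"
    and R: "R \<subseteq> lattice ((2 + 2) + (2 + 2))"
    and x0: "x0 \<in> lattice ((2 + 2) + (2 + 2))" "x0 \<noteq> 0\<^sub>v ((2 + 2) + (2 + 2))" "\<And>r. r \<in> R \<Longrightarrow> r \<bullet> x0 = 0"
    and inv: "\<And>x r. x \<in> lattice ((2 + 2) + (2 + 2)) \<Longrightarrow> (\<And>r. r \<in> R \<Longrightarrow> r \<bullet> x = 0) \<Longrightarrow> r \<in> R \<Longrightarrow>
      r \<bullet> (I_mat (imag_class t) *\<^sub>v x) = 0"
  shows "R \<subseteq> {0\<^sub>v ((2 + 2) + (2 + 2))}"
proof
  fix r assume r: "r \<in> R"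
  \<comment> \<open>\<open>K\<close> is the lattice of integral solutions of \<open>R\<close>, in four blocks of length two.\<close>
  define K where "K v1 v2 w1 w2 \<longleftrightarrow> v1 \<in> lattice 2 \<and> v2 \<in> lattice 2 \<and> w1 \<in> lattice 2 \<and> w2 \<in> lattice 2 \<and>
    (\<forall>p1\<in>lattice 2. \<forall>p2\<in>lattice 2. \<forall>q1\<in>lattice 2. \<forall>q2\<in>lattice 2. (p1 @\<^sub>v p2) @\<^sub>v (q1 @\<^sub>v q2) \<in> R \<longrightarrow>
      p1 \<bullet> v1 + p2 \<bullet> v2 + (q1 \<bullet> w1 + q2 \<bullet> w2) = 0)" for v1 v2 w1 w2
  have pairing_split: "((p1 @\<^sub>v p2) @\<^sub>v (q1 @\<^sub>v q2)) \<bullet> ((v1 @\<^sub>v v2) @\<^sub>v (w1 @\<^sub>v w2)) = p1 \<bullet> v1 + p2 \<bullet> v2 + (q1 \<bullet> w1 + q2 \<bullet> w2)"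
    if "p1 \<in> lattice 2" "p2 \<in> lattice 2" "q1 \<in> lattice 2" "q2 \<in> lattice 2"
      "v1 \<in> lattice 2" "v2 \<in> lattice 2" "w1 \<in> lattice 2" "w2 \<in> lattice 2" for p1 p2 q1 q2 v1 v2 w1 w2 :: "real vec"
  proof -
    note cv = that[THEN lattice_carrier]
    show ?thesis
      unfolding scalar_prod_append[OF append_carrier_vec[OF cv(1,2)] append_carrier_vec[OF cv(3,4)]
          append_carrier_vec[OF cv(5,6)] append_carrier_vec[OF cv(7,8)]]
        scalar_prod_append[OF cv(1,2,5,6)] scalar_prod_append[OF cv(3,4,7,8)] ..
  qed
  have decomp: "\<exists>p1\<in>lattice 2. \<exists>p2\<in>lattice 2. \<exists>q1\<in>lattice 2. \<exists>q2\<in>lattice 2. z = (p1 @\<^sub>v p2) @\<^sub>v (q1 @\<^sub>v q2)"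
    if "z \<in> lattice ((2 + 2) + (2 + 2))" for z
    by (metis lattice_append_cases that)
  have orth: "q1 \<bullet> (\<psi> *\<^sub>v v1) = 0 \<and> q2 \<bullet> (\<psi> *\<^sub>v v2) = 0 \<and> q1 \<bullet> (\<psi> *\<^sub>v v2) + q2 \<bullet> (\<psi> *\<^sub>v v1) = 0 \<and>
      q1 \<bullet> (\<psi> *\<^sub>v (G *\<^sub>v v2)) - q2 \<bullet> (\<psi> *\<^sub>v (G *\<^sub>v v1)) = 0 \<and>
      p1 \<bullet> (\<psi> *\<^sub>v w1) = 0 \<and> p2 \<bullet> (\<psi> *\<^sub>v w2) = 0 \<and> p1 \<bullet> (\<psi> *\<^sub>v w2) + p2 \<bullet> (\<psi> *\<^sub>v w1) = 0 \<and>
      p1 \<bullet> (G *\<^sub>v (\<psi> *\<^sub>v w2)) - p2 \<bullet> (G *\<^sub>v (\<psi> *\<^sub>v w1)) = 0"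
    if K: "K v1 v2 w1 w2" and p: "p1 \<in> lattice 2" "p2 \<in> lattice 2" "q1 \<in> lattice 2" "q2 \<in> lattice 2"
      and pR: "(p1 @\<^sub>v p2) @\<^sub>v (q1 @\<^sub>v q2) \<in> R" for v1 v2 w1 w2 p1 p2 q1 q2
  proof (rule rational_annihilation[OF t _ _ _ _ p])
    show v: "v1 \<in> lattice 2" "v2 \<in> lattice 2" "w1 \<in> lattice 2" "w2 \<in> lattice 2" using K by (auto simp: K_def)
    show "((p1 @\<^sub>v p2) @\<^sub>v (q1 @\<^sub>v q2)) \<bullet> (I_mat (imag_class t) *\<^sub>v ((v1 @\<^sub>v v2) @\<^sub>v (w1 @\<^sub>v w2))) = 0"
    proof (rule inv[OF _ _ pR])
      show "(v1 @\<^sub>v v2) @\<^sub>v (w1 @\<^sub>v w2) \<in> lattice ((2 + 2) + (2 + 2))"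
        using v[THEN lattice_carrier] v by (simp only: lattice_append_iff append_carrier_vec)
      fix s assume s: "s \<in> R"
      then have "s \<in> lattice ((2 + 2) + (2 + 2))" using R by blast
      from decomp[OF this] obtain a1 a2 b1 b2 where s': "a1 \<in> lattice 2" "a2 \<in> lattice 2" "b1 \<in> lattice 2" "b2 \<in> lattice 2"
        "s = (a1 @\<^sub>v a2) @\<^sub>v (b1 @\<^sub>v b2)" by blast
      show "s \<bullet> ((v1 @\<^sub>v v2) @\<^sub>v (w1 @\<^sub>v w2)) = 0"
        using K s s'(1-4) unfolding s'(5) pairing_split[OF s'(1-4) v] K_def by blast
    qed
  qed
  have minus: "p \<bullet> (- v) = - (p \<bullet> v)" if "p \<in> lattice 2" "v \<in> lattice 2" for p v :: "real vec"
    using that[THEN lattice_carrier] by simp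
  have zero: "p \<bullet> 0\<^sub>v 2 = 0" if "p \<in> lattice 2" for p :: "real vec"
    using that[THEN lattice_carrier] by simp
  note lat = \<psi>_lattice G_lattice lattice_zero lattice_uminus
  have Klat: "v1 \<in> lattice 2" "v2 \<in> lattice 2" "w1 \<in> lattice 2" "w2 \<in> lattice 2" if "K v1 v2 w1 w2" for v1 v2 w1 w2
    using that by (auto simp: K_def)
  let ?o = "0\<^sub>v 2 :: real vec"
  \<comment> \<open>Stability under the coefficient matrices: \<open>N\<close> for those of \<open>\<Phi>\<close>, \<open>M\<close> for those of its adjugate.\<close>
  have Na: "K ?o ?o (\<psi> *\<^sub>v v1) ?o" and Nb: "K ?o ?o ?o (\<psi> *\<^sub>v v2)"
    and Nx: "K ?o ?o (\<psi> *\<^sub>v v2) (\<psi> *\<^sub>v v1)" and Ny: "K ?o ?o (\<psi> *\<^sub>v (G *\<^sub>v v2)) (- (\<psi> *\<^sub>v (G *\<^sub>v v1)))"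
    and Mb: "K (\<psi> *\<^sub>v w1) ?o ?o ?o" and Ma: "K ?o (\<psi> *\<^sub>v w2) ?o ?o"
    and Mx: "K (\<psi> *\<^sub>v w2) (\<psi> *\<^sub>v w1) ?o ?o" and My: "K (G *\<^sub>v (\<psi> *\<^sub>v w2)) (- (G *\<^sub>v (\<psi> *\<^sub>v w1))) ?o ?o"
    if K: "K v1 v2 w1 w2" for v1 v2 w1 w2
    unfolding K_def using Klat[OF K] orth[OF K] by (auto simp: zero minus lat)
  have \<psi>o [simp]: "\<psi> *\<^sub>v ?o = ?o" "G *\<^sub>v ?o = ?o" "- ?o = ?o"
    by (auto intro!: vec_two_eqI simp: mult_vec_two simp del: index_mult_mat_vec)
  have nz: "\<psi> *\<^sub>v v \<noteq> ?o" if "v \<in> lattice 2" "v \<noteq> ?o" for v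
    using \<psi>_inj lattice_carrier that by blast
  \<comment> \<open>Whichever block of \<open>x0\<close> is nonzero can be moved to the first position, with the others erased.\<close>
  obtain u where u: "K u ?o ?o ?o" "u \<noteq> ?o"
  proof -
    obtain v1 v2 w1 w2 where v: "v1 \<in> lattice 2" "v2 \<in> lattice 2" "w1 \<in> lattice 2" "w2 \<in> lattice 2"
      and x0': "x0 = (v1 @\<^sub>v v2) @\<^sub>v (w1 @\<^sub>v w2)" using decomp[OF x0(1)] by blast
    have K: "K v1 v2 w1 w2"
      unfolding K_def using v x0(3) pairing_split[OF _ _ _ _ v] unfolding x0' by metis
    have "v1 \<noteq> ?o \<or> v2 \<noteq> ?o \<or> w1 \<noteq> ?o \<or> w2 \<noteq> ?o"
      using x0(2) unfolding x0' by (auto simp: append_zero_vec[of 2 2, simplified] append_zero_vec[of 4 4, simplified])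
    then consider "v1 \<noteq> ?o" | "v2 \<noteq> ?o" | "w1 \<noteq> ?o" | "w2 \<noteq> ?o" by blast
    then show thesis
    proof cases
      case 1
      show thesis by (rule that[OF Mb[OF Na[OF K]]]) (intro nz lat v 1)
    next
      case 2
      show thesis by (rule that[OF Mx[OF Nb[OF K], simplified]]) (intro nz lat v 2)
    next
      case 3
      show thesis by (rule that[OF Mb[OF K]]) (intro nz v 3)
    next
      case 4
      show thesis by (rule that[OF Mx[OF Nb[OF Ma[OF K]], simplified]]) (intro nz lat v 4)
    qed
  qed
  have uL: "u \<in> lattice 2" and uc: "u \<in> carrier_vec 2" using Klat[OF u(1)] lattice_carrier by auto
  obtain p1 p2 q1 q2 where p: "p1 \<in> lattice 2" "p2 \<in> lattice 2" "q1 \<in> lattice 2" "q2 \<in> lattice 2"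
      and r': "r = (p1 @\<^sub>v p2) @\<^sub>v (q1 @\<^sub>v q2)" using decomp[OF subsetD[OF R r]] by blast
  note pc = p[THEN lattice_carrier]
  have ev: "p1 \<bullet> v1 + p2 \<bullet> v2 + (q1 \<bullet> w1 + q2 \<bullet> w2) = 0" if "K v1 v2 w1 w2" for v1 v2 w1 w2
    using that p r unfolding K_def r' by blast
  have sq: "s \<bullet> (\<psi> *\<^sub>v (\<psi> *\<^sub>v v)) = 0 \<Longrightarrow> s \<bullet> v = 0" if "s \<in> lattice 2" "v \<in> carrier_vec 2" for s v
    using that \<psi>_nonzero lattice_carrier[OF that(1)] by (simp add: \<psi>_sq del: assoc_mult_mat_vec)
  have Gsq: "s \<bullet> (G *\<^sub>v (\<psi> *\<^sub>v (\<psi> *\<^sub>v v))) = 0 \<Longrightarrow> s \<bullet> (G *\<^sub>v v) = 0" if "s \<in> lattice 2" "v \<in> carrier_vec 2" for s v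
    using that \<psi>_nonzero lattice_carrier[OF that(1)] by (simp add: \<psi>_sq mult_mat_vec[of _ 2 2] del: assoc_mult_mat_vec)
  \<comment> \<open>From \<open>u\<close> in the first block, each block is reached by multiples of both \<open>u\<close> and \<open>G u\<close> (or of their images under \<open>\<psi>\<close>), which forces all four blocks of \<open>r\<close> to vanish.\<close>
  note k1 = Nx[OF u(1), simplified]
  note k2 = Ny[OF u(1), simplified]
  have "p1 = ?o"
  proof (rule spanning[OF uc u(2) pc(1)])
    show "p1 \<bullet> u = 0" using ev[OF u(1)] p by (simp add: zero)
    show "p1 \<bullet> (G *\<^sub>v u) = 0"
      using ev[OF My[OF k1]] p by (intro Gsq[OF _ uc]) (simp_all add: zero)
  qed
  moreover have "p2 = ?o"
  proof (rule spanning[OF uc u(2) pc(2)])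
    show "p2 \<bullet> u = 0" using ev[OF Ma[OF k1]] p by (intro sq[OF _ uc]) (simp_all add: zero)
    have "p2 \<bullet> (\<psi> *\<^sub>v (- (\<psi> *\<^sub>v (G *\<^sub>v u)))) = 0" using ev[OF Ma[OF k2]] p by (simp add: zero)
    moreover have "\<psi> *\<^sub>v (- (\<psi> *\<^sub>v (G *\<^sub>v u))) = - (\<psi> *\<^sub>v (\<psi> *\<^sub>v (G *\<^sub>v u)))"
      using uc by (intro vec_two_eqI) (auto simp: mult_vec_two simp del: index_mult_mat_vec)
    ultimately have "p2 \<bullet> (\<psi> *\<^sub>v (\<psi> *\<^sub>v (G *\<^sub>v u))) = 0"
      using minus[OF p(2) \<psi>_lattice[OF \<psi>_lattice[OF G_lattice[OF uL]]]] by (metis neg_equal_0_iff_equal)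
    then show "p2 \<bullet> (G *\<^sub>v u) = 0" by (rule sq[OF p(2) mult_carrier(3)[OF uc]])
  qed
  moreover have "q1 = ?o"
  proof (rule spanning_dual[OF uc u(2) pc(3)])
    show "q1 \<bullet> (\<psi> *\<^sub>v u) = 0" using ev[OF Na[OF u(1)]] p by (simp add: zero)
    have "q1 \<bullet> (\<psi> *\<^sub>v (G *\<^sub>v (\<psi> *\<^sub>v (\<psi> *\<^sub>v u)))) = 0" using ev[OF Na[OF My[OF k1]]] p by (simp add: zero)
    moreover have "\<psi> *\<^sub>v (G *\<^sub>v (\<psi> *\<^sub>v (\<psi> *\<^sub>v u))) = - ((\<psi> $$ (0,1))\<^sup>2) \<cdot>\<^sub>v (\<psi> *\<^sub>v (G *\<^sub>v u))"
      unfolding \<psi>_sq[OF uc] using uc by (simp add: mult_mat_vec[of _ 2 2])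
    ultimately show "q1 \<bullet> (\<psi> *\<^sub>v (G *\<^sub>v u)) = 0" using \<psi>_nonzero pc(3) uc by (simp del: assoc_mult_mat_vec)
  qed
  moreover have "q2 = ?o"
  proof (rule spanning_dual[OF uc u(2) pc(4)])
    show "q2 \<bullet> (\<psi> *\<^sub>v u) = 0" using ev[OF k1] p by (simp add: zero)
    show "q2 \<bullet> (\<psi> *\<^sub>v (G *\<^sub>v u)) = 0" using ev[OF k2] p uL by (simp add: zero minus lat)
  qed
  ultimately show "r \<in> {0\<^sub>v ((2 + 2) + (2 + 2))}" unfolding r' by (simp add: append_zero_vec)
qed

end

section \<open>The invariant sublattice attached to a mirror pair\<close>

lemma complex_torus_carrier: "complex_torus B \<Longrightarrow> B \<in> carrier_mat (dim_row B) (dim_row B)"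
  by (simp add: complex_torus_def)

text \<open>
  The last \<open>n\<close> rows of \<open>\<alpha>\<close> are integral equations for the preimage of \<open>V\<^sub>B\<close>. The preimage is stable
  under \<open>I\<^sub>\<omega>\<close> because \<open>\<alpha>\<close> carries \<open>I\<^sub>\<omega>\<close> to a block diagonal matrix. That it is neither zero nor the
  whole space follows from bijectivity of \<open>\<alpha>\<close> on the lattices.
\<close>
theorem mirror_gives_invariant_sublattice:
  assumes mirror: "mirror_symmetric A \<omega> B \<omega>\<^sub>B" and B: "complex_torus B"
    and m: "dim_row A = m" "m > 0" and I: "I_mat \<omega> \<in> carrier_mat (m + m) (m + m)"
  obtains R x0 where "R \<subseteq> lattice (m + m)" "\<not> R \<subseteq> {0\<^sub>v (m + m)}"
    "x0 \<in> lattice (m + m)" "x0 \<noteq> 0\<^sub>v (m + m)" "\<And>r. r \<in> R \<Longrightarrow> r \<bullet> x0 = 0"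
    "\<And>x r. x \<in> lattice (m + m) \<Longrightarrow> (\<And>r. r \<in> R \<Longrightarrow> r \<bullet> x = 0) \<Longrightarrow> r \<in> R \<Longrightarrow> r \<bullet> (I_mat \<omega> *\<^sub>v x) = 0"
proof -
  define n where "n = dim_row B"
  have Bc: "B \<in> carrier_mat n n" unfolding n_def by (rule complex_torus_carrier[OF B])
  obtain \<alpha> where \<alpha>: "\<alpha> \<in> carrier_mat (n + n) (m + m)"
    and bij: "bij_betw (\<lambda>x. \<alpha> *\<^sub>v x) (lattice (m + m)) (lattice (n + n))"
    and comm: "\<alpha> * I_mat \<omega> = prod_torus B (dual_torus B) * \<alpha>"
    using mirror unfolding mirror_symmetric_def Let_def m(1) n_def[symmetric] by (elim bexE conjE) (rule that)
  define P where "P = prod_torus B (dual_torus B)"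
  have P: "P \<in> carrier_mat (n + n) (n + n)"
    unfolding P_def prod_torus_def dual_torus_def using Bc by (intro four_block_carrier_mat) auto
  define R where "R = row \<alpha> ` {n..<n + n}"
  have row: "row \<alpha> i \<bullet> x = (\<alpha> *\<^sub>v x) $ i" if "i < n + n" for i x
    using \<alpha> that by simp
  have onto: "\<exists>x\<in>lattice (m + m). \<alpha> *\<^sub>v x = y" if "y \<in> lattice (n + n)" for y
    using bij that unfolding bij_betw_def by (metis imageE)
  have \<alpha>0: "\<alpha> *\<^sub>v 0\<^sub>v (m + m) = 0\<^sub>v (n + n)" using \<alpha> by (intro eq_vecI) auto
  \<comment> \<open>For \<open>n = 0\<close> the target lattice is a single point.\<close>
  have "n > 0"
  proof (rule ccontr)
    assume "\<not> n > 0"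
    then have "\<alpha> *\<^sub>v unit_vec (m + m) 0 = \<alpha> *\<^sub>v 0\<^sub>v (m + m)" using \<alpha> by (intro eq_vecI) auto
    then have "unit_vec (m + m) 0 = (0\<^sub>v (m + m) :: real vec)"
      using bij lattice_unit_vec lattice_zero unfolding bij_betw_def inj_on_def by blast
    then show False using m by (metis add_gr_0 index_unit_vec(2) index_zero_vec(1) zero_neq_one)
  qed
  obtain x0 where x0: "x0 \<in> lattice (m + m)" "\<alpha> *\<^sub>v x0 = unit_vec (n + n) 0"
    using onto lattice_unit_vec by blast
  show thesis
  proof (rule that)
    show "R \<subseteq> lattice (m + m)"
    proof
      fix r assume "r \<in> R"
      then obtain i where i: "i < n + n" "r = row \<alpha> i" by (auto simp: R_def)
      have "r $ j \<in> \<int>" if j: "j < m + m" for j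
        using integral_entries[OF \<alpha> _ i(1) j] bij i j \<alpha> unfolding bij_betw_def by auto
      then show "r \<in> lattice (m + m)" using i \<alpha> by (auto simp: lattice_def)
    qed
    obtain y where y: "y \<in> lattice (m + m)" "\<alpha> *\<^sub>v y = unit_vec (n + n) n"
      using onto lattice_unit_vec by blast
    have "row \<alpha> n \<bullet> y = 1" using row[of n y] y \<open>n > 0\<close> by simp
    then have "row \<alpha> n \<noteq> 0\<^sub>v (m + m)" using lattice_carrier[OF y(1)] by auto
    moreover have "row \<alpha> n \<in> R" using \<open>n > 0\<close> by (simp add: R_def)
    ultimately show "\<not> R \<subseteq> {0\<^sub>v (m + m)}" by blast
    show "x0 \<in> lattice (m + m)" by fact
    show "x0 \<noteq> 0\<^sub>v (m + m)"
    proof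
      assume "x0 = 0\<^sub>v (m + m)"
      then have "unit_vec (n + n) 0 = (0\<^sub>v (n + n) :: real vec)" using x0 \<alpha>0 by simp
      then show False using \<open>n > 0\<close> by (metis add_gr_0 index_unit_vec(2) index_zero_vec(1) zero_neq_one)
    qed
    show "r \<bullet> x0 = 0" if "r \<in> R" for r
      using that row[of _ x0] x0(2) \<open>n > 0\<close> by (auto simp: R_def)
    show "r \<bullet> (I_mat \<omega> *\<^sub>v x) = 0"
      if x: "x \<in> lattice (m + m)" and 0: "\<And>r. r \<in> R \<Longrightarrow> r \<bullet> x = 0" and r: "r \<in> R" for x r
    proof -
      note xc = lattice_carrier[OF x]
      have \<alpha>x: "\<alpha> *\<^sub>v x \<in> carrier_vec (n + n)" using \<alpha> xc by (rule mult_mat_vec_carrier)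
      obtain u w where uw: "\<alpha> *\<^sub>v x = u @\<^sub>v w" "u \<in> carrier_vec n" "w \<in> carrier_vec n"
        by (rule carrier_append_cases[OF \<alpha>x])
      have "w = 0\<^sub>v n"
      proof (rule eq_vecI)
        fix i assume i: "i < dim_vec (0\<^sub>v n :: real vec)"
        then have "row \<alpha> (n + i) \<bullet> x = 0" by (intro 0) (auto simp: R_def)
        then have "(\<alpha> *\<^sub>v x) $ (n + i) = 0" using i row by simp
        then show "w $ i = (0\<^sub>v n :: real vec) $ i" using i uw by simp
      qed (use uw in auto)
      then have "P *\<^sub>v (\<alpha> *\<^sub>v x) = (B *\<^sub>v u + 0\<^sub>m n n *\<^sub>v 0\<^sub>v n) @\<^sub>v (0\<^sub>m n n *\<^sub>v u + dual_torus B *\<^sub>v 0\<^sub>v n)"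
        using uw Bc unfolding P_def prod_torus_def
        by (simp, subst four_block_mat_mult_vec[of _ n n _ n _ n]) (auto simp: dual_torus_def)
      moreover have "0\<^sub>m n n *\<^sub>v u + dual_torus B *\<^sub>v 0\<^sub>v n = 0\<^sub>v n"
        using Bc uw by (intro eq_vecI) (auto simp: dual_torus_def)
      ultimately have P\<alpha>: "(P *\<^sub>v (\<alpha> *\<^sub>v x)) $ i = 0" if "n \<le> i" "i < n + n" for i
        using that Bc by simp
      obtain i where i: "n \<le> i" "i < n + n" "r = row \<alpha> i" using r by (auto simp: R_def)
      have "r \<bullet> (I_mat \<omega> *\<^sub>v x) = (\<alpha> *\<^sub>v (I_mat \<omega> *\<^sub>v x)) $ i" using i row by simp
      also have "\<alpha> *\<^sub>v (I_mat \<omega> *\<^sub>v x) = P *\<^sub>v (\<alpha> *\<^sub>v x)"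
        using assoc_mult_mat_vec[OF \<alpha> I xc] assoc_mult_mat_vec[OF P \<alpha> xc] comm P_def by simp
      finally show ?thesis using P\<alpha> i by simp
    qed
  qed
qed

theorem (in CM_curve) no_mirror:
  assumes t: "\<not> algebraic t" and B: "abelian_variety B"
  shows "\<not> mirror_symmetric (prod_torus J J) (imag_class t) B \<omega>\<^sub>B"
proof
  assume mirror: "mirror_symmetric (prod_torus J J) (imag_class t) B \<omega>\<^sub>B"
  have B: "complex_torus B" using B by (simp add: abelian_variety_def)
  have I: "I_mat (imag_class t) \<in> carrier_mat ((2 + 2) + (2 + 2)) ((2 + 2) + (2 + 2))"
    unfolding I_mat_imag_class[OF t] by (intro four_block_carrier_mat) auto
  show False
  proof (rule mirror_gives_invariant_sublattice[OF mirror B prod_torus_dim _ I])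
    show "(0::nat) < 2 + 2" by simp
    fix R x0
    assume R: "R \<subseteq> lattice ((2 + 2) + (2 + 2))" "\<not> R \<subseteq> {0\<^sub>v ((2 + 2) + (2 + 2))}"
      and x0: "x0 \<in> lattice ((2 + 2) + (2 + 2))" "x0 \<noteq> 0\<^sub>v ((2 + 2) + (2 + 2))" "\<And>r. r \<in> R \<Longrightarrow> r \<bullet> x0 = 0"
      and inv: "\<And>x r. x \<in> lattice ((2 + 2) + (2 + 2)) \<Longrightarrow> (\<And>r. r \<in> R \<Longrightarrow> r \<bullet> x = 0) \<Longrightarrow> r \<in> R \<Longrightarrow>
        r \<bullet> (I_mat (imag_class t) *\<^sub>v x) = 0"
    show False using no_invariant_sublattice[OF t R(1) x0 inv] R(2) by blast
  qed
qed

section \<open>Elliptic curves with complex multiplication\<close>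

text \<open>
  In dimension two an endomorphism \<open>f\<close> that commutes with \<open>J\<close> has the form \<open>p + q J\<close>. Its trace-free
  part doubled, \<open>2 f - tr f = 2 q J\<close>, is integral, and \<open>q \<noteq> 0\<close> unless \<open>f\<close> is an integral scalar.
\<close>
lemma CM_multiple_integral:
  assumes J: "J \<in> carrier_mat 2 2" "J * J = - 1\<^sub>m 2" and CM: "has_CM J"
  shows "\<exists>c. c \<noteq> 0 \<and> (\<forall>i<2. \<forall>j<2. c * J $$ (i,j) \<in> \<int>)"
proof -
  have dim: "dim_row J = 2" using J by auto
  have "of_int k \<cdot>\<^sub>m 1\<^sub>m 2 \<in> torus_End J" for k
    unfolding torus_End_def dim using J
    by (auto simp: mult_smult_distrib[of _ 2 2 _ 2] mult_smult_assoc_mat[of _ 2 2 _ 2] intro!: lattice_mult_mat_vec)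
  then obtain f where f: "f \<in> torus_End J" and nonscalar: "\<And>k. f \<noteq> of_int k \<cdot>\<^sub>m 1\<^sub>m 2"
    using CM unfolding has_CM_def dim by blast
  have fc: "f \<in> carrier_mat 2 2" and fl: "\<And>v. v \<in> lattice 2 \<Longrightarrow> f *\<^sub>v v \<in> lattice 2" and fJ: "f * J = J * f"
    using f unfolding torus_End_def dim by auto
  have fi: "f $$ (i,j) \<in> \<int>" if "i < 2" "j < 2" for i j
    by (rule integral_entries[OF fc fl that])
  note JE = complex_structure_two[OF J]
  have e: "(f * J) $$ (i,j) = (J * f) $$ (i,j)" for i j by (simp only: fJ)
  have e1: "f $$ (0,1) * J $$ (1,0) = J $$ (0,1) * f $$ (1,0)"
    using e[of 0 0] fc J by (simp add: mult_mat_two del: index_mult_mat)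
  have e2: "J $$ (0,1) * (f $$ (0,0) - f $$ (1,1)) = 2 * f $$ (0,1) * J $$ (0,0)"
    using e[of 0 1] fc J by (simp add: mult_mat_two JE(1) algebra_simps del: index_mult_mat)
  \<comment> \<open>This is \<open>2 q\<close>.\<close>
  define c where "c = 2 * f $$ (0,1) / J $$ (0,1)"
  have c01: "c * J $$ (0,1) = 2 * f $$ (0,1)" using JE(3) by (simp add: c_def)
  have c10: "c * J $$ (1,0) = 2 * f $$ (1,0)" using JE(3) e1 by (simp add: c_def field_simps)
  have c00: "c * J $$ (0,0) = f $$ (0,0) - f $$ (1,1)" using JE(3) e2 by (simp add: c_def field_simps)
  have c11: "c * J $$ (1,1) = - (f $$ (0,0) - f $$ (1,1))" using c00 JE(1) by simp
  have "c \<noteq> 0"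
  proof
    assume "c = 0"
    then have 0: "f $$ (0,1) = 0" "f $$ (1,0) = 0" "f $$ (1,1) = f $$ (0,0)" using c01 c10 c00 by auto
    obtain k where k: "f $$ (0,0) = of_int k" using fi[of 0 0] by (auto elim: Ints_cases)
    have "f = of_int k \<cdot>\<^sub>m 1\<^sub>m 2"
      using fc 0 k by (intro mat_two_eqI) auto
    then show False using nonscalar by blast
  qed
  moreover have "c * J $$ (i,j) \<in> \<int>" if "i < 2" "j < 2" for i j
    using that fi[of 0 0] fi[of 0 1] fi[of 1 0] fi[of 1 1]
    by (auto simp: less_two_iff c00 c01 c10 c11)
  ultimately show ?thesis by blast
qed

lemma CM_curve_exists:
  assumes E: "elliptic_curve E" and CM: "has_CM E"
  shows "\<exists>\<psi> c. CM_curve E \<psi> c"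
proof -
  have dim: "dim_row E = 2" using E by (simp add: elliptic_curve_def)
  have J: "E \<in> carrier_mat 2 2" "E * E = - 1\<^sub>m 2"
    using E unfolding elliptic_curve_def abelian_variety_def complex_torus_def by auto
  obtain \<psi> where "ample_class E \<psi>" using E unfolding elliptic_curve_def abelian_variety_def by blast
  then have NS: "\<psi> \<in> NS E" and ample: "\<forall>v\<in>carrier_vec 2. v \<noteq> 0\<^sub>v 2 \<longrightarrow> form \<psi> (E *\<^sub>v v) v > 0"
    unfolding ample_class_def dim by blast+
  have \<psi>: "\<psi> \<in> carrier_mat 2 2"
    and int: "\<And>v w. v \<in> lattice 2 \<Longrightarrow> w \<in> lattice 2 \<Longrightarrow> form \<psi> v w \<in> \<int>"
    and skew: "\<And>v w. v \<in> lattice 2 \<Longrightarrow> w \<in> lattice 2 \<Longrightarrow> form \<psi> v w = - form \<psi> w v"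
    using NS unfolding NS_def dim by blast+
  have pos: "\<And>v. v \<in> carrier_vec 2 \<Longrightarrow> v \<noteq> 0\<^sub>v 2 \<Longrightarrow> 0 < (\<psi> *\<^sub>v (E *\<^sub>v v)) \<bullet> v"
    using ample unfolding form_def by blast
  have entry: "form \<psi> (unit_vec 2 j) (unit_vec 2 i) = \<psi> $$ (i,j)" if "i < 2" "j < 2" for i j
    using \<psi> that by (simp add: form_def)
  have sk: "\<psi> $$ (i,j) = - \<psi> $$ (j,i)" if "i < 2" "j < 2" for i j
    using skew[OF lattice_unit_vec lattice_unit_vec, of j i] entry that by simp
  obtain c where c: "c \<noteq> 0" "\<forall>i<2. \<forall>j<2. c * E $$ (i,j) \<in> \<int>" using CM_multiple_integral[OF J CM] by blast
  have "CM_curve E \<psi> c"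
  proof
    show "\<psi> $$ (0,0) = 0" "\<psi> $$ (1,1) = 0" "\<psi> $$ (1,0) = - \<psi> $$ (0,1)"
      using sk[of 0 0] sk[of 1 1] sk[of 1 0] by simp_all
    show "\<psi> $$ (0,1) \<in> \<int>" using int[OF lattice_unit_vec lattice_unit_vec, of 1 0] entry by simp
  qed (use J \<psi> pos c in auto)
  then show ?thesis by blast
qed

text \<open>
  The square lattice: multiplication by \<open>i\<close> is an endomorphism.
\<close>
lemma CM_elliptic_curve_exists: "\<exists>E. elliptic_curve E \<and> has_CM E"
proof -
  define E :: "real mat" where "E = mat 2 2 (\<lambda>(i,j). if i = j then 0 else if i = 0 then - 1 else 1)"
  have Ec: "E \<in> carrier_mat 2 2" by (simp add: E_def)
  then have [simp]: "dim_row E = 2" "dim_col E = 2" by auto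
  have e [simp]: "E $$ (0,0) = 0" "E $$ (0,1) = - 1" "E $$ (1,0) = 1" "E $$ (1,1) = 0"
    by (simp_all add: E_def)
  have EE: "E * E = - 1\<^sub>m 2"
    using Ec by (intro mat_two_eqI) (auto simp: mult_mat_two simp del: index_mult_mat(1))
  let ?\<psi> = "- E"
  have \<psi>c: "?\<psi> \<in> carrier_mat 2 2" using Ec by simp
  have form: "form ?\<psi> v w = v $ 1 * w $ 0 - v $ 0 * w $ 1" if [simp]: "v \<in> carrier_vec 2" "w \<in> carrier_vec 2" for v w
    unfolding form_def using \<psi>c
    by (subst scalar_prod_two) (auto simp: mult_vec_two simp del: index_mult_mat_vec intro: mult_mat_vec_carrier)
  have Ev: "E *\<^sub>v v \<in> carrier_vec 2" "(E *\<^sub>v v) $ 0 = - v $ 1" "(E *\<^sub>v v) $ 1 = v $ 0" if "v \<in> carrier_vec 2" for v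
    using that Ec by (auto simp: mult_vec_two simp del: index_mult_mat_vec intro: mult_mat_vec_carrier)
  have "?\<psi> \<in> NS E"
    unfolding NS_def using \<psi>c
    by (auto simp: form Ev lattice_carrier simp del: index_mult_mat_vec) (auto simp: lattice_def intro!: Ints_diff Ints_mult)
  moreover have "0 < form ?\<psi> (E *\<^sub>v v) v" if v: "v \<in> carrier_vec 2" "v \<noteq> 0\<^sub>v 2" for v
  proof -
    have "v $ 0 \<noteq> 0 \<or> v $ 1 \<noteq> 0" using v by (auto intro: vec_two_eqI)
    then have "0 < v $ 0 * v $ 0 + v $ 1 * v $ 1" by (metis sum_squares_gt_zero_iff)
    then show ?thesis using v by (simp add: form Ev del: index_mult_mat_vec)
  qed
  ultimately have "elliptic_curve E"
    using Ec EE unfolding elliptic_curve_def abelian_variety_def ample_class_def complex_torus_def by auto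
  moreover have "has_CM E"
  proof -
    have "E \<in> torus_End E" unfolding torus_End_def using Ec
      by (auto intro!: lattice_mult_mat_vec[of _ 2 2] simp: less_two_iff)
    moreover have "E \<noteq> of_int k \<cdot>\<^sub>m 1\<^sub>m 2" for k
    proof
      assume "E = of_int k \<cdot>\<^sub>m 1\<^sub>m 2"
      then have "E $$ (0,1) = (of_int k \<cdot>\<^sub>m 1\<^sub>m 2 :: real mat) $$ (0,1)" by simp
      then show False by simp
    qed
    ultimately show ?thesis unfolding has_CM_def by auto
  qed
  ultimately show ?thesis by blast
qed

theorem mainTheorem11:
  shows
    "(\<exists>A \<omega>. algebraic_pair A \<omega> \<and>
        \<not> (\<exists>B \<omega>\<^sub>B. algebraic_pair B \<omega>\<^sub>B \<and> mirror_symmetric A \<omega> B \<omega>\<^sub>B)) \<and>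
     (\<forall>E. elliptic_curve E \<longrightarrow> has_CM E \<longrightarrow>
        abelian_variety (prod_torus E E) \<and>
        (\<exists>\<omega>\<in>complexified_cone (prod_torus E E).
           \<not> (\<exists>B \<omega>\<^sub>B. algebraic_pair B \<omega>\<^sub>B \<and>
                mirror_symmetric (prod_torus E E) \<omega> B \<omega>\<^sub>B)))"
proof -
  have main: "abelian_variety (prod_torus E E) \<and>
        (\<exists>\<omega>\<in>complexified_cone (prod_torus E E).
           \<not> (\<exists>B \<omega>\<^sub>B. algebraic_pair B \<omega>\<^sub>B \<and> mirror_symmetric (prod_torus E E) \<omega> B \<omega>\<^sub>B))"
    if E: "elliptic_curve E" "has_CM E" for E
  proof -
    obtain \<psi> c where "CM_curve E \<psi> c" using CM_curve_exists[OF E] by blast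
    then interpret CM_curve E \<psi> c .
    obtain t :: real where "t > 0" "\<not> algebraic t" using exists_positive_transcendental by blast
    then show ?thesis using abelian_prod imag_class_in_cone no_mirror unfolding algebraic_pair_def by blast
  qed
  moreover obtain E where "elliptic_curve E" "has_CM E" using CM_elliptic_curve_exists by blast
  ultimately show ?thesis unfolding algebraic_pair_def by blast
qed

end
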